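(* Let $n,m\ge 1$ be integers and $n_\theta=n\left(\frac{3n+1}{2}+2m\right)+m^2$. Let $H_0\in\mathbb{C}^{m\times m}$, $\theta_0\in\mathbb{R}^{n_\theta}$ and $s_0\in\mathbb{C}$ be given, and assume that $H_{\mathsf{pH}}(s_0,\cdot):\Omega_{\theta_0}\to\mathbb{C}^{m\times m}$ (i.e. $H_{\mathsf{pH}}(s_0,\cdot)$ is defined on $\Omega_{\theta_0}$), where $\Omega_{\theta_0}\subseteq\mathbb{R}^{n_\theta}$ is a neighborhood of $\theta_0$. Furthermore, assume that the maximal singular value of $H_0-H_{\mathsf{pH}}(s_0,\theta_0)$ is simple, and let $\hat u,\hat v\in\mathbb{C}^m$ be the left and right singular vectors corresponding to the maximal singular value of $H_0-H_{\mathsf{pH}}(s_0,\theta_0)$, respectively. Then $\theta\mapsto\|H_0-H_{\mathsf{pH}}(s_0,\theta)\|_2$ is differentiable in a neighborhood of $\theta_0$. Moreover, let $\mathcal{D}_0=s_0E(\theta_0)-(J(\theta_0)-R(\theta_0))$ be invertible and define $$a:=\mathcal{D}_0^{-1}(B(\theta_0)-P(\theta_0))\hat v,\qquad b:=\mathcal{D}_0^{-\mathsf H}(B(\theta_0)+P(\theta_0))\hat u,\qquad M:=\begin{bmatrix}a^{\mathsf T}&\hat v^{\mathsf T}\end{bmatrix}^{\mathsf T}\begin{bmatrix}-b^{\mathsf H}&\hat u^{\mathsf H}\end{bmatrix}\in\mathbb{C}^{(n+m)\times(n+m)}.$$ Then the gradient with respect to $\theta$ of $\theta\mapsto\|H_0-H_{\mathsf{pH}}(s_0,\theta)\|_2$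 at $\theta_0$ is $[d\theta_E^{\mathsf T},d\theta_J^{\mathsf T},d\theta_W^{\mathsf T},d\theta_B^{\mathsf T},d\theta_N^{\mathsf T}]^{\mathsf T}$, where, with $\theta_E$ and $\theta_W$ denoting the corresponding blocks of $\theta_0$, $$d\theta_E=-\mathrm{Re}\left(\mathrm{utv}\left(-s_0\,\mathrm{vtu}(\theta_E)\left((ab^{\mathsf H})^{\mathsf T}+ab^{\mathsf H}\right)\right)\right),$$ $$d\theta_J=-\mathrm{Re}\left(\mathrm{sutv}\left(-ab^{\mathsf H}+(ab^{\mathsf H})^{\mathsf T}\right)\right),$$ $$d\theta_W=-\mathrm{Re}\left(\mathrm{utv}\left(\mathrm{vtu}(\theta_W)\left(M^{\mathsf T}+M\right)\right)\right),$$ $$d\theta_B=-\mathrm{Re}\left(\mathrm{vec}\left(a\hat u^{\mathsf H}+(\hat v b^{\mathsf H})^{\mathsf T}\right)\right),$$ $$d\theta_N=-\mathrm{Re}\left(\mathrm{sutv}\left(-\hat v\hat u^{\mathsf H}+(\hat v\hat u^{\mathsf H})^{\mathsf T}\right)\right).$$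
   Context: Reshaping functions: $\mathrm{vtf}_m$ maps a vector $v$ of length $k m$ to the $k\times m$ matrix obtained by filling columns in order (entry $(i,j)$ is $v_{(j-1)k+i}$); its inverse is the standard column-wise vectorization $\mathrm{vec}$. $\mathrm{vtu}$ maps a vector of length $k(k+1)/2$ to the $k\times k$ upper triangular matrix whose upper triangular part (including the diagonal) is filled row by row: first row $v_1,\dots,v_k$; second row $0,v_{k+1},\dots,v_{2k-1}$; and so on. $\mathrm{utv}$ maps a $k\times k$ matrix to the vector of length $k(k+1)/2$ listing its upper triangular part (including the diagonal) row-wise. $\mathrm{vtsu}$ maps a vector of length $k(k-1)/2$ to the $k\times k$ strictly upper triangular matrix whose strictly upper triangular part is filled row by row. $\mathrm{sutv}$ maps a $k\times k$ matrix to the vector of length $k(k-1)/2$ listing its strictly upper triangular part row-wise. Parametrization: $\theta\in\mathbb{R}^{n_\theta}$ is partitioned as $\theta=[\theta_E^{\mathsf T},\theta_J^{\mathsf T},\theta_W^{\mathsf T},\theta_B^{\mathsf T},\theta_N^{\mathsf T}]^{\mathsf T}$ with $\theta_E\in\mathbb{R}^{n(n+1)/2}$, $\theta_J\in\mathbb{R}^{n(n-1)/2}$, $\theta_W\in\mathbb{R}^{(n+m)(n+m+1)/2}$, $\theta_B\in\mathbb{R}^{nm}$, $\theta_N\in\mathbb{R}^{m(m-1)/2}$, and $E(\theta):=\mathrm{vtu}(\theta_E)^{\mathsf T}\mathrm{vtu}(\theta_E)$, $J(\theta):=\mathrm{vtsu}(\theta_J)^{\mathsf T}-\mathrm{vtsu}(\theta_J)$,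 $W(\theta):=\mathrm{vtu}(\theta_W)^{\mathsf T}\mathrm{vtu}(\theta_W)$, $B(\theta):=\mathrm{vtf}_m(\theta_B)\in\mathbb{R}^{n\times m}$, $N(\theta):=\mathrm{vtsu}(\theta_N)^{\mathsf T}-\mathrm{vtsu}(\theta_N)$, and $R(\theta)\in\mathbb{R}^{n\times n}$, $P(\theta)\in\mathbb{R}^{n\times m}$, $S(\theta)\in\mathbb{R}^{m\times m}$ are the blocks of $W(\theta)=\begin{bmatrix}R(\theta)&P(\theta)\\P(\theta)^{\mathsf T}&S(\theta)\end{bmatrix}$. Transfer function: $H_{\mathsf{pH}}(s,\theta):=(B(\theta)+P(\theta))^{\mathsf T}\left(sE(\theta)-(J(\theta)-R(\theta))\right)^{-1}(B(\theta)-P(\theta))+S(\theta)+N(\theta)$. Conventions: $\|\cdot\|_2$ is the spectral norm (maximal singular value); $^{\mathsf T}$ is the transpose (without conjugation), $^{\mathsf H}$ the conjugate transpose, $\mathcal{D}_0^{-\mathsf H}=(\mathcal{D}_0^{-1})^{\mathsf H}$; $\mathrm{Re}$ is the entrywise real part. Left and right singular vectors $\hat u,\hat v$ of a matrix $X$ for the singular value $\sigma$ are a matched pair of unit vectors with $X\hat v=\sigma\hat u$ and $X^{\mathsf H}\hat u=\sigma\hat v$.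
   Formalization: The signs of dθ_J and dθ_N are reversed, since the printed ones are the negatives of the true partial derivatives; and H_0 ≠ H_pH(s_0,θ_0) is assumed, which only matters for m=1, where the norm need not be differentiable at a zero difference. *)

theory Defs
  imports "HOL-Analysis.Analysis"
begin

section \<open>Ordered index types\<close>

text \<open>
  A matrix with \<open>r\<close> rows and \<open>c\<close> columns is an element of \<^typ>\<open>'a^'c^'r\<close> where \<open>'r\<close>, \<open>'c\<close> are
  finite linearly ordered types with \<open>r\<close> and \<open>c\<close> elements. Vectors of length \<open>k(k+1)/2\<close> and the
  like have no index type, so they are represented as lists.
\<close>

text \<open>The index type of the block matrix \<open>W\<close> is \<open>'n + 'm\<close>, with the \<open>'n\<close> block first.\<close>

instantiation sum :: (linorder, linorder) linorder
begin

fun less_eq_sum :: "'a + 'b \<Rightarrow> 'a + 'b \<Rightarrow> bool" where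
  "less_eq_sum (Inl a) (Inl b) = (a \<le> b)"
| "less_eq_sum (Inl a) (Inr b) = True"
| "less_eq_sum (Inr a) (Inl b) = False"
| "less_eq_sum (Inr a) (Inr b) = (a \<le> b)"

definition less_sum :: "'a + 'b \<Rightarrow> 'a + 'b \<Rightarrow> bool" where
  "less_sum x y \<longleftrightarrow> x \<le> y \<and> \<not> y \<le> x"

instance
proof
  fix x y z :: "'a + 'b"
  show "x < y \<longleftrightarrow> x \<le> y \<and> \<not> y \<le> x"
    by (rule less_sum_def)
  show "x \<le> x"
    by (cases x) auto
  show "x \<le> y \<Longrightarrow> y \<le> z \<Longrightarrow> x \<le> z"
    by (cases x; cases y; cases z) auto
  show "x \<le> y \<Longrightarrow> y \<le> x \<Longrightarrow> x = y"
    by (cases x; cases y) auto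
  show "x \<le> y \<or> y \<le> x"
    by (cases x; cases y) auto
qed

end

text \<open>\<open>pos i\<close> is the position of \<open>i\<close> counted from 0.\<close>

definition pos :: "'k::{finite,linorder} \<Rightarrow> nat" where
  "pos i = card {j. j < i}"

abbreviation idxs :: "'k::{finite,linorder} list" where
  "idxs \<equiv> sorted_list_of_set UNIV"

definition vec_to_list :: "'a^'k::{finite,linorder} \<Rightarrow> 'a list" where
  "vec_to_list x = [x $ i. i \<leftarrow> idxs]"

definition list_to_vec :: "'a list \<Rightarrow> 'a^'k::{finite,linorder}" where
  "list_to_vec xs = (\<chi> i. xs ! pos i)"


section \<open>Reshaping functions\<close>

definition vtf :: "'a list \<Rightarrow> 'a^'c::{finite,linorder}^'r::{finite,linorder}" where
  "vtf v = (\<chi> i j. v ! (pos j * CARD('r) + pos i))"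

definition vec_cols :: "'a^'c::{finite,linorder}^'r::{finite,linorder} \<Rightarrow> 'a list" where
  "vec_cols A = [A $ i $ j. j \<leftarrow> idxs, i \<leftarrow> idxs]"

text \<open>
  Counted from 0, row \<open>p\<close> of the upper triangular part has \<open>k - p\<close> entries and starts on the
  diagonal; row \<open>p\<close> of the strictly upper triangular part has \<open>k - 1 - p\<close> entries and starts just
  right of the diagonal.
\<close>

definition vtu :: "'a::zero list \<Rightarrow> 'a^'k::{finite,linorder}^'k::{finite,linorder}" where
  "vtu v = (\<chi> i j. if i \<le> j
     then v ! ((\<Sum>p<pos i. CARD('k) - p) + (pos j - pos i)) else 0)"

definition utv :: "'a^'k::{finite,linorder}^'k::{finite,linorder} \<Rightarrow> 'a list" where
  "utv A = [A $ i $ j. i \<leftarrow> idxs, j \<leftarrow> idxs, i \<le> j]"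

definition vtsu :: "'a::zero list \<Rightarrow> 'a^'k::{finite,linorder}^'k::{finite,linorder}" where
  "vtsu v = (\<chi> i j. if i < j
     then v ! ((\<Sum>p<pos i. CARD('k) - 1 - p) + (pos j - pos i - 1)) else 0)"

definition sutv :: "'a^'k::{finite,linorder}^'k::{finite,linorder} \<Rightarrow> 'a list" where
  "sutv A = [A $ i $ j. i \<leftarrow> idxs, j \<leftarrow> idxs, i < j]"


section \<open>Complex matrices and singular values\<close>

abbreviation cmat :: "real^'c^'r \<Rightarrow> complex^'c^'r" where
  "cmat \<equiv> map_matrix complex_of_real"

abbreviation smult_mat :: "complex \<Rightarrow> complex^'c^'r \<Rightarrow> complex^'c^'r" where
  "smult_mat c \<equiv> map_matrix ((*) c)"

definition conj_transpose :: "complex^'c^'r \<Rightarrow> complex^'r^'c" where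
  "conj_transpose A = map_matrix cnj (transpose A)"

text \<open>\<open>outer_H x y\<close> is the rank-one matrix \<open>x y\<^sup>H\<close>.\<close>

definition outer_H :: "complex^'r \<Rightarrow> complex^'c \<Rightarrow> complex^'c^'r" where
  "outer_H x y = (\<chi> i j. x $ i * cnj (y $ j))"

definition vec_append :: "'a^'n \<Rightarrow> 'a^'m \<Rightarrow> 'a^('n + 'm)" where
  "vec_append x y = (\<chi> i. case i of Inl k \<Rightarrow> x $ k | Inr k \<Rightarrow> y $ k)"

definition singular_space :: "complex^'c^'r \<Rightarrow> real \<Rightarrow> (complex^'c) set" where
  "singular_space X \<sigma> = {x. (conj_transpose X ** X) *v x = complex_of_real (\<sigma>\<^sup>2) *s x}"

definition singular_values :: "complex^'c^'r \<Rightarrow> real set" where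
  "singular_values X = {\<sigma>. 0 \<le> \<sigma> \<and> (\<exists>x. x \<noteq> 0 \<and> x \<in> singular_space X \<sigma>)}"

definition spectral_norm :: "complex^'c^'r \<Rightarrow> real" where
  "spectral_norm X = Max (singular_values X)"

text \<open>
  The multiplicity of \<open>\<sigma>\<close> is that of the eigenvalue \<open>\<sigma>\<^sup>2\<close> of \<open>X\<^sup>H X\<close>; this matrix is Hermitian, so
  geometric and algebraic multiplicity agree.
\<close>

definition simple_singular_value :: "complex^'c^'r \<Rightarrow> real \<Rightarrow> bool" where
  "simple_singular_value X \<sigma> \<longleftrightarrow>
     \<sigma> \<in> singular_values X \<and> vec.dim (singular_space X \<sigma>) = 1"

definition singular_vectors :: "complex^'c^'r \<Rightarrow> real \<Rightarrow> complex^'r \<Rightarrow> complex^'c \<Rightarrow> bool" where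
  "singular_vectors X \<sigma> u v \<longleftrightarrow> norm u = 1 \<and> norm v = 1 \<and>
     X *v v = complex_of_real \<sigma> *s u \<and> conj_transpose X *v u = complex_of_real \<sigma> *s v"


section \<open>Parametrized port-Hamiltonian systems\<close>

text \<open>
  The parameter vector is split into blocks of lengths \<open>n(n+1)/2\<close>, \<open>n(n-1)/2\<close>,
  \<open>(n+m)(n+m+1)/2\<close>, \<open>n m\<close> and \<open>m(m-1)/2\<close>. The argument of type \<^typ>\<open>('n \<times> 'm) itself\<close> supplies
  \<open>n = CARD('n)\<close> and \<open>m = CARD('m)\<close>.
\<close>

definition len_E :: "('n::finite \<times> 'm::finite) itself \<Rightarrow> nat" where
  "len_E d = CARD('n) * (CARD('n) + 1) div 2"

definition len_J :: "('n::finite \<times> 'm::finite) itself \<Rightarrow> nat" where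
  "len_J d = CARD('n) * (CARD('n) - 1) div 2"

definition len_W :: "('n::finite \<times> 'm::finite) itself \<Rightarrow> nat" where
  "len_W d = (CARD('n) + CARD('m)) * (CARD('n) + CARD('m) + 1) div 2"

definition len_B :: "('n::finite \<times> 'm::finite) itself \<Rightarrow> nat" where
  "len_B d = CARD('n) * CARD('m)"

definition len_N :: "('n::finite \<times> 'm::finite) itself \<Rightarrow> nat" where
  "len_N d = CARD('m) * (CARD('m) - 1) div 2"

context
  fixes d :: "('n::{finite,linorder} \<times> 'm::{finite,linorder}) itself"
begin

definition par_E :: "real^'p::{finite,linorder} \<Rightarrow> real list" where
  "par_E \<theta> = take (len_E d) (vec_to_list \<theta>)"

definition par_J :: "real^'p::{finite,linorder} \<Rightarrow> real list" where
  "par_J \<theta> = take (len_J d) (drop (len_E d) (vec_to_list \<theta>))"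

definition par_W :: "real^'p::{finite,linorder} \<Rightarrow> real list" where
  "par_W \<theta> = take (len_W d) (drop (len_E d + len_J d) (vec_to_list \<theta>))"

definition par_B :: "real^'p::{finite,linorder} \<Rightarrow> real list" where
  "par_B \<theta> = take (len_B d) (drop (len_E d + len_J d + len_W d) (vec_to_list \<theta>))"

definition par_N :: "real^'p::{finite,linorder} \<Rightarrow> real list" where
  "par_N \<theta> = take (len_N d) (drop (len_E d + len_J d + len_W d + len_B d) (vec_to_list \<theta>))"

definition pH_E :: "real^'p::{finite,linorder} \<Rightarrow> real^'n::{finite,linorder}^'n::{finite,linorder}" where
  "pH_E \<theta> = transpose (vtu (par_E \<theta>)) ** vtu (par_E \<theta>)"

text \<open>
  With \<open>J = V\<^sup>T - V\<close>, the derivative of \<open>tr (J K)\<close> with respect to the entry \<open>V\<^sub>i\<^sub>j\<close>, \<open>i < j\<close>, is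
  \<open>K\<^sub>i\<^sub>j - K\<^sub>j\<^sub>i\<close>, not \<open>K\<^sub>j\<^sub>i - K\<^sub>i\<^sub>j\<close>; the same holds for \<open>N\<close>. This fixes the sign of the gradient
  blocks that belong to the skew-symmetric matrices.
\<close>

definition pH_J :: "real^'p::{finite,linorder} \<Rightarrow> real^'n::{finite,linorder}^'n::{finite,linorder}" where
  "pH_J \<theta> = transpose (vtsu (par_J \<theta>)) - vtsu (par_J \<theta>)"

definition pH_W :: "real^'p::{finite,linorder} \<Rightarrow> real^('n::{finite,linorder} + 'm::{finite,linorder})^('n::{finite,linorder} + 'm::{finite,linorder})" where
  "pH_W \<theta> = transpose (vtu (par_W \<theta>)) ** vtu (par_W \<theta>)"

definition pH_R :: "real^'p::{finite,linorder} \<Rightarrow> real^'n::{finite,linorder}^'n::{finite,linorder}" where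
  "pH_R \<theta> = (\<chi> i j. pH_W \<theta> $ Inl i $ Inl j)"

definition pH_P :: "real^'p::{finite,linorder} \<Rightarrow> real^'m::{finite,linorder}^'n::{finite,linorder}" where
  "pH_P \<theta> = (\<chi> i j. pH_W \<theta> $ Inl i $ Inr j)"

definition pH_S :: "real^'p::{finite,linorder} \<Rightarrow> real^'m::{finite,linorder}^'m::{finite,linorder}" where
  "pH_S \<theta> = (\<chi> i j. pH_W \<theta> $ Inr i $ Inr j)"

definition pH_B :: "real^'p::{finite,linorder} \<Rightarrow> real^'m::{finite,linorder}^'n::{finite,linorder}" where
  "pH_B \<theta> = vtf (par_B \<theta>)"

definition pH_N :: "real^'p::{finite,linorder} \<Rightarrow> real^'m::{finite,linorder}^'m::{finite,linorder}" where
  "pH_N \<theta> = transpose (vtsu (par_N \<theta>)) - vtsu (par_N \<theta>)"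

definition pH_pencil :: "complex \<Rightarrow> real^'p::{finite,linorder} \<Rightarrow> complex^'n::{finite,linorder}^'n::{finite,linorder}" where
  "pH_pencil s \<theta> = smult_mat s (cmat (pH_E \<theta>)) - cmat (pH_J \<theta> - pH_R \<theta>)"

text \<open>
  \<^const>\<open>matrix_inv\<close> is total; the transfer function is defined at \<open>(s, \<theta>)\<close> exactly when
  \<open>pH_pencil s \<theta>\<close> is invertible.
\<close>

definition H_pH :: "complex \<Rightarrow> real^'p::{finite,linorder} \<Rightarrow> complex^'m::{finite,linorder}^'m::{finite,linorder}" where
  "H_pH s \<theta> =
     cmat (transpose (pH_B \<theta> + pH_P \<theta>)) ** matrix_inv (pH_pencil s \<theta>) ** cmat (pH_B \<theta> - pH_P \<theta>)
     + cmat (pH_S \<theta>) + cmat (pH_N \<theta>)"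

end

end

theory Submission
  imports Defs
begin

text \<open>
  The spectral norm is the support function of the compact set \<open>K\<close> of matrices \<open>u v\<^sup>H\<close> with unit
  vectors \<open>u\<close>, \<open>v\<close>: with respect to the real inner product of matrices it equals \<open>max {G \<bullet> X | G \<in> K}\<close>.
  By Danskin's argument it is differentiable at \<open>X\<close>, with gradient \<open>u v\<^sup>H\<close>, as soon as this maximizer
  is unique. For \<open>X \<noteq> 0\<close> uniqueness can only fail if there are two orthonormal right singular vectors
  for the maximal singular value, and by compactness the matrices having such a pair form a closed
  set; so differentiability at \<open>\<theta>0\<close> extends to a neighbourhood without the implicit function theorem.
  The gradient with respect to \<open>\<theta>\<close> is then read off from \<open>Re (u\<^sup>H dH v)\<close> by the product rule and
  \<open>d(D\<^sup>-\<^sup>1) = - D\<^sup>-\<^sup>1 dD D\<^sup>-\<^sup>1\<close>, using that each reshaping function into matrices is adjoint to the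
  corresponding function into lists.
\<close>

section \<open>The Hermitian inner product and rank-one matrices\<close>

text \<open>The Hermitian product \<open>x^H y\<close>, conjugate-linear in the first argument. Its
  real part is the product \<open>\<bullet>\<close>, which alone does not detect complex
  orthogonality.\<close>

definition hinner :: "complex^'n \<Rightarrow> complex^'n \<Rightarrow> complex" where
  "hinner x y = (\<Sum>i\<in>UNIV. cnj (x $ i) * y $ i)"

lemma inner_eq_Re_hinner: "x \<bullet> y = Re (hinner x y)" for x y :: "complex^'n"
  by (simp add: hinner_def inner_vec_def inner_complex_def)

lemma hinner_self: "hinner x x = of_real ((norm x)\<^sup>2)"
  by (simp add: hinner_def power2_norm_eq_inner inner_vec_def inner_complex_def complex_eq_iff
      algebra_simps)

lemma hinner_add_right: "hinner x (y + z) = hinner x y + hinner x z"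
  and hinner_diff_right: "hinner x (y - z) = hinner x y - hinner x z"
  and hinner_smult_right: "hinner x (c *s y) = c * hinner x y"
  and hinner_smult_left: "hinner (c *s x) y = cnj c * hinner x y"
  and hinner_minus_right: "hinner x (- y) = - hinner x y"
  by (simp_all add: hinner_def sum.distrib sum_subtractf sum_distrib_left algebra_simps sum_negf)

lemma hinner_adjoint: "hinner x (A *v y) = hinner (conj_transpose A *v x) y"
proof -
  have "hinner x (A *v y) = (\<Sum>i\<in>UNIV. \<Sum>j\<in>UNIV. cnj (x $ i) * (A $ i $ j * y $ j))"
    by (simp add: hinner_def matrix_vector_mult_def sum_distrib_left)
  also have "\<dots> = (\<Sum>j\<in>UNIV. \<Sum>i\<in>UNIV. cnj (x $ i) * (A $ i $ j * y $ j))"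
    by (rule sum.swap)
  also have "\<dots> = hinner (conj_transpose A *v x) y"
    by (simp add: hinner_def matrix_vector_mult_def conj_transpose_def map_matrix_def transpose_def
        sum_distrib_right sum_distrib_left algebra_simps)
  finally show ?thesis .
qed

lemma inner_adjoint: "x \<bullet> (A *v y) = (conj_transpose A *v x) \<bullet> y" for A :: "complex^'c^'r"
  by (simp add: inner_eq_Re_hinner hinner_adjoint)

lemma conj_transpose_conj_transpose: "conj_transpose (conj_transpose A) = A"
  by (simp add: conj_transpose_def map_matrix_def transpose_def vec_eq_iff)

lemma smult_of_real: "complex_of_real r *s x = r *\<^sub>R x" for x :: "complex^'n"
  by (simp add: vec_eq_iff scaleR_conv_of_real[where 'a = complex])

lemma norm_smult: "norm (c *s x) = cmod c * norm x" for x :: "complex^'n"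
proof -
  have "complex_of_real ((norm (c *s x))\<^sup>2) = of_real ((cmod c * norm x)\<^sup>2)"
    unfolding hinner_self[symmetric] hinner_smult_left hinner_smult_right
    by (simp add: hinner_self power_mult_distrib complex_norm_square algebra_simps
        flip: of_real_power)
  then show ?thesis
    by (simp only: of_real_eq_iff) (simp add: power2_eq_iff_nonneg)
qed

text \<open>Both sides are \<open>Re (u^H X v)\<close>. This turns the bilinear expression in
  \<open>u\<close> and \<open>v\<close> into a linear functional of \<open>X\<close>.\<close>

lemma inner_outer_H: "outer_H u v \<bullet> X = u \<bullet> (X *v v)"
  by (simp add: outer_H_def inner_vec_def inner_complex_def matrix_vector_mult_def
      inner_eq_Re_hinner hinner_def sum_distrib_left algebra_simps sum.distrib sum_subtractf)

lemma continuous_on_matrix_vector_mult [continuous_intros]: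
  fixes f :: "'a::topological_space \<Rightarrow> complex^'c^'r"
  assumes "continuous_on S f" "continuous_on S g"
  shows "continuous_on S (\<lambda>x. f x *v g x)"
  unfolding matrix_vector_mult_def by (intro continuous_intros assms)

lemma continuous_on_hinner [continuous_intros]:
  assumes "continuous_on S f" "continuous_on S g"
  shows "continuous_on S (\<lambda>x. hinner (f x) (g x))"
  unfolding hinner_def by (intro continuous_intros assms)

lemma continuous_on_outer_H [continuous_intros]:
  assumes "continuous_on S f" "continuous_on S g"
  shows "continuous_on S (\<lambda>x. outer_H (f x) (g x))"
  unfolding outer_H_def by (intro continuous_intros assms)

text \<open>The equality case of Cauchy-Schwarz: expanding the square of
  \<open>norm (x - r *\<^sub>R y)\<close> leaves at most
  \<open>r^2 - 2 r^2 + r^2 = 0\<close>.\<close>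

lemma eq_scaleR_if_inner_ge:
  fixes x y :: "'a::real_inner"
  assumes "norm x \<le> r" "norm y = 1" "x \<bullet> y \<ge> r"
  shows "x = r *\<^sub>R y"
proof -
  have "0 \<le> r" using assms norm_ge_zero order_trans by blast
  have "(norm (x - r *\<^sub>R y))\<^sup>2 = (norm x)\<^sup>2 - 2 * r * (x \<bullet> y) + r\<^sup>2"
    using assms(2) unfolding norm_eq_1 power2_norm_eq_inner
    by (simp add: inner_diff_left inner_diff_right inner_commute power2_eq_square)
  also have "\<dots> \<le> r\<^sup>2 - 2 * r * r + r\<^sup>2"
    using assms \<open>0 \<le> r\<close> by (intro add_mono diff_mono power_mono mult_left_mono) auto
  finally have "(norm (x - r *\<^sub>R y))\<^sup>2 \<le> 0" by (simp add: power2_eq_square)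
  then show ?thesis by simp
qed

section \<open>The spectral norm as an operator norm\<close>

text \<open>The square of \<open>norm (X^H y)\<close> is \<open>y \<bullet> X (X^H y)\<close>, hence
  at most \<open>norm y * \<sigma> * norm (X^H y)\<close>; one factor cancels.\<close>

lemma norm_conj_transpose_le:
  fixes X :: "complex^'c^'r"
  assumes "\<And>x. norm (X *v x) \<le> \<sigma> * norm x"
  shows "norm (conj_transpose X *v y) \<le> \<sigma> * norm y"
proof -
  let ?z = "conj_transpose X *v y"
  have "(norm ?z)\<^sup>2 = y \<bullet> (X *v ?z)"
    by (simp add: power2_norm_eq_inner inner_adjoint)
  also have "\<dots> \<le> norm y * (\<sigma> * norm ?z)"
    by (meson assms mult_left_mono norm_cauchy_schwarz norm_ge_zero order_trans)
  finally have *: "norm ?z * norm ?z \<le> (\<sigma> * norm y) * norm ?z"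
    by (simp add: power2_eq_square mult_ac)
  \<comment> \<open>\<open>axis undefined 1\<close> serves as some unit vector.\<close>
  have "0 \<le> \<sigma>" using assms[of "axis undefined 1"] norm_ge_zero[of "X *v axis undefined 1"]
    by (simp del: norm_ge_zero)
  show ?thesis
  proof (cases "norm ?z = 0")
    case True then show ?thesis using \<open>0 \<le> \<sigma>\<close> by simp
  next
    case False then show ?thesis using * by simp
  qed
qed

text \<open>If \<open>norm (X v) = \<sigma>\<close>, then \<open>X^H X v\<close> has norm at most
  \<open>\<sigma>^2\<close> and inner product \<open>\<sigma>^2\<close> with the unit vector
  \<open>v\<close>, so it equals \<open>\<sigma>^2 v\<close>. This replaces the eigenvalue equation
  by an extremality condition.\<close>

lemma top_singular_space:
  fixes X :: "complex^'c^'r"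
  assumes bound: "\<And>x. norm (X *v x) \<le> \<sigma> * norm x" and "norm v = 1"
  shows "norm (X *v v) = \<sigma> \<longleftrightarrow> v \<in> singular_space X \<sigma>"
proof
  assume nv: "norm (X *v v) = \<sigma>"
  let ?w = "conj_transpose X *v (X *v v)"
  have "norm ?w \<le> \<sigma>\<^sup>2"
    using norm_conj_transpose_le[OF bound, of "X *v v"] nv by (simp add: power2_eq_square)
  moreover have "?w \<bullet> v = \<sigma>\<^sup>2"
    unfolding nv[symmetric] by (simp add: power2_norm_eq_inner flip: inner_adjoint)
  ultimately have "?w = \<sigma>\<^sup>2 *\<^sub>R v"
    using \<open>norm v = 1\<close> by (intro eq_scaleR_if_inner_ge) auto
  then show "v \<in> singular_space X \<sigma>"
    by (simp add: singular_space_def smult_of_real flip: matrix_vector_mul_assoc of_real_power)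
next
  assume "v \<in> singular_space X \<sigma>"
  then have *: "conj_transpose X *v (X *v v) = \<sigma>\<^sup>2 *\<^sub>R v"
    by (simp add: singular_space_def smult_of_real flip: matrix_vector_mul_assoc of_real_power)
  have "0 \<le> \<sigma>" using bound[of v] assms(2) norm_ge_zero[of "X *v v"] by (simp del: norm_ge_zero)
  have "(norm (X *v v))\<^sup>2 = \<sigma>\<^sup>2"
    using * \<open>norm v = 1\<close> unfolding norm_eq_1 by (simp add: power2_norm_eq_inner inner_adjoint)
  then show "norm (X *v v) = \<sigma>" using \<open>0 \<le> \<sigma>\<close> by (simp add: power2_eq_iff_nonneg)
qed

lemma singular_space_smult: "x \<in> singular_space X \<sigma> \<Longrightarrow> c *s x \<in> singular_space X \<sigma>"
  by (simp add: singular_space_def vec.scale mult.commute)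

lemma singular_space_diff:
  "x \<in> singular_space X \<sigma> \<Longrightarrow> y \<in> singular_space X \<sigma> \<Longrightarrow> x - y \<in> singular_space X \<sigma>"
  by (simp add: singular_space_def vec.diff vector_space_over_itself.scale_right_diff_distrib vec.scale_right_diff_distrib)

lemma singular_space_unit:
  assumes "x \<in> singular_space X \<sigma>" "x \<noteq> 0"
  shows "complex_of_real (inverse (norm x)) *s x \<in> singular_space X \<sigma>"
    and "norm (complex_of_real (inverse (norm x)) *s x) = 1"
  using assms by (auto simp: norm_smult norm_inverse intro: singular_space_smult)

lemma singular_value_eq_norm:
  assumes "\<sigma> \<in> singular_values X"
  obtains x where "norm x = 1" "x \<in> singular_space X \<sigma>" "norm (X *v x) = \<sigma>"
proof -
  obtain y where y: "y \<noteq> 0" "y \<in> singular_space X \<sigma>" and "0 \<le> \<sigma>"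
    using assms by (auto simp: singular_values_def)
  let ?x = "complex_of_real (inverse (norm y)) *s y"
  have x: "?x \<in> singular_space X \<sigma>" "norm ?x = 1" using singular_space_unit y by auto
  then have *: "conj_transpose X *v (X *v ?x) = \<sigma>\<^sup>2 *\<^sub>R ?x"
    by (simp add: singular_space_def smult_of_real flip: matrix_vector_mul_assoc of_real_power)
  have "(norm (X *v ?x))\<^sup>2 = (conj_transpose X *v (X *v ?x)) \<bullet> ?x"
    by (simp only: power2_norm_eq_inner inner_adjoint)
  also have "\<dots> = \<sigma>\<^sup>2" unfolding * using x(2) unfolding norm_eq_1 by simp
  finally have "norm (X *v ?x) = \<sigma>" using \<open>0 \<le> \<sigma>\<close> by (simp add: power2_eq_iff_nonneg)
  then show ?thesis using x that by blast
qed

text \<open>Unit eigenvectors of the Hermitian matrix \<open>X^H X\<close> for different eigenvalues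
  are orthogonal, and a pairwise orthogonal set is finite. Finiteness gives \<open>Max\<close> in
  \<open>spectral_norm\<close> its meaning.\<close>

lemma finite_singular_values: "finite (singular_values X)"
proof -
  define x where "x \<sigma> = (SOME x. norm x = 1 \<and> x \<in> singular_space X \<sigma>)" for \<sigma>
  have x: "norm (x \<sigma>) = 1" "x \<sigma> \<in> singular_space X \<sigma>" if "\<sigma> \<in> singular_values X" for \<sigma>
    using someI_ex[of "\<lambda>x. norm x = 1 \<and> x \<in> singular_space X \<sigma>"] singular_value_eq_norm[OF that]
    by (auto simp: x_def)
  have orth: "x \<sigma> \<bullet> x \<tau> = 0" if "\<sigma> \<in> singular_values X" "\<tau> \<in> singular_values X" "\<sigma> \<noteq> \<tau>" for \<sigma> \<tau>
  proof -
    have "\<sigma>\<^sup>2 *\<^sub>R x \<sigma> = conj_transpose X *v (X *v x \<sigma>)" "\<tau>\<^sup>2 *\<^sub>R x \<tau> = conj_transpose X *v (X *v x \<tau>)"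
      using x that by (auto simp: singular_space_def smult_of_real simp flip: matrix_vector_mul_assoc of_real_power)
    then have "(\<sigma>\<^sup>2 *\<^sub>R x \<sigma>) \<bullet> x \<tau> = x \<sigma> \<bullet> (\<tau>\<^sup>2 *\<^sub>R x \<tau>)"
      by (simp only: inner_adjoint conj_transpose_conj_transpose)
    then have "(\<sigma>\<^sup>2 - \<tau>\<^sup>2) * (x \<sigma> \<bullet> x \<tau>) = 0" by (simp add: algebra_simps)
    \<comment> \<open>Singular values are nonnegative, so squaring is injective on them.\<close>
    moreover have "\<sigma>\<^sup>2 \<noteq> \<tau>\<^sup>2" using that by (auto simp: singular_values_def power2_eq_iff_nonneg)
    ultimately show ?thesis by simp
  qed
  have "inj_on x (singular_values X)"
  proof (rule inj_onI, rule ccontr)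
    fix \<sigma> \<tau> assume *: "\<sigma> \<in> singular_values X" "\<tau> \<in> singular_values X" "x \<sigma> = x \<tau>" "\<sigma> \<noteq> \<tau>"
    then show False using orth[of \<sigma> \<tau>] x(1)[of \<tau>] unfolding norm_eq_1 by simp
  qed
  moreover have "pairwise orthogonal (x ` singular_values X)"
    using orth by (auto simp: pairwise_def orthogonal_def)
  then have "finite (x ` singular_values X)" by (rule pairwise_orthogonal_imp_finite)
  ultimately show ?thesis by (simp add: finite_image_iff)
qed

text \<open>The maximum over the compact unit sphere exists and extends to all vectors by
  homogeneity.\<close>

lemma norm_matrix_vector_attains_bound:
  fixes X :: "complex^'c^'r"
  obtains v where "norm v = 1" "\<And>x. norm (X *v x) \<le> norm (X *v v) * norm x"
proof -
  have "\<exists>v\<in>sphere 0 1. \<forall>x\<in>sphere 0 1. norm (X *v x) \<le> norm (X *v v)"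
    by (intro continuous_attains_sup continuous_intros) auto
  then obtain v where v: "norm v = 1" "\<And>x. norm x = 1 \<Longrightarrow> norm (X *v x) \<le> norm (X *v v)"
    by auto
  have "norm (X *v x) \<le> norm (X *v v) * norm x" for x
  proof (cases "x = 0")
    case False
    have "X *v (norm x *\<^sub>R sgn x) = norm x *\<^sub>R (X *v sgn x)"
      by (rule linear_scale) simp
    then have "X *v x = norm x *\<^sub>R (X *v sgn x)"
      using False by (simp add: sgn_div_norm)
    then show ?thesis using v(2)[of "sgn x"] False by (simp add: norm_sgn mult.commute mult_left_mono)
  qed simp
  then show ?thesis using that v by blast
qed

text \<open>The operator norm is itself a singular value by \<open>top_singular_space\<close>, and
  each singular value is the norm of \<open>X x\<close> for some unit vector \<open>x\<close>, so
  none is larger.\<close>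

lemma spectral_norm_eqI:
  assumes "norm v = 1" "\<And>x. norm (X *v x) \<le> norm (X *v v) * norm x"
  shows "spectral_norm X = norm (X *v v)"
  unfolding spectral_norm_def
proof (rule Max_eqI[OF finite_singular_values])
  have "v \<in> singular_space X (norm (X *v v))" using assms top_singular_space by blast
  moreover have "v \<noteq> 0" using assms by auto
  ultimately show "norm (X *v v) \<in> singular_values X" by (auto simp: singular_values_def)
next
  fix \<sigma> assume "\<sigma> \<in> singular_values X"
  then obtain x where "norm x = 1" "norm (X *v x) = \<sigma>" using singular_value_eq_norm by blast
  then show "\<sigma> \<le> norm (X *v v)" using assms(2)[of x] by simp
qed

lemma norm_matrix_vector_le_spectral_norm: "norm (X *v x) \<le> spectral_norm X * norm x"
  using norm_matrix_vector_attains_bound[of X] spectral_norm_eqI by metis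

lemma spectral_norm_attained: obtains v where "norm v = 1" "norm (X *v v) = spectral_norm X"
  using norm_matrix_vector_attains_bound[of X] spectral_norm_eqI by metis

lemma spectral_norm_pos: assumes "X \<noteq> 0" shows "spectral_norm X > 0"
proof -
  obtain x where "X *v x \<noteq> 0" using assms matrix_eq[of X 0] by auto
  then have "0 < spectral_norm X * norm x" using norm_matrix_vector_le_spectral_norm[of X x]
    by (meson order_less_le_trans zero_less_norm_iff)
  then show ?thesis by (simp add: zero_less_mult_iff)
qed

text \<open>For \<open>x = 0\<close> any unit vector serves, so a left vector \<open>u\<close> is
  available even where \<open>X\<close> vanishes.\<close>

lemma exists_unit_scaleR: obtains u :: "complex^'n" where "norm u = 1" "x = norm x *\<^sub>R u"
proof (cases "x = 0")
  case True
  then show ?thesis using that[of "axis undefined 1"] by simp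
next
  case False
  then show ?thesis using that[of "sgn x"] by (simp add: norm_sgn sgn_div_norm)
qed

section \<open>Differentiability of the spectral norm\<close>

definition rank_one_units :: "(complex^'c^'r) set" where
  "rank_one_units = (\<lambda>(u, v). outer_H u v) ` (sphere 0 1 \<times> sphere 0 1)"

lemma compact_rank_one_units: "compact rank_one_units"
  unfolding rank_one_units_def case_prod_beta
  by (intro compact_continuous_image continuous_intros compact_Times) auto

lemma inner_rank_one_units_le: "G \<in> rank_one_units \<Longrightarrow> G \<bullet> X \<le> spectral_norm X"
proof -
  assume "G \<in> rank_one_units"
  then obtain u v where "G = outer_H u v" "norm u = 1" "norm v = 1" by (auto simp: rank_one_units_def)
  then show ?thesis
    using norm_cauchy_schwarz[of u "X *v v"] norm_matrix_vector_le_spectral_norm[of X v]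
    by (simp add: inner_outer_H)
qed

lemma spectral_norm_attained_rank_one: "\<exists>G\<in>rank_one_units. G \<bullet> X = spectral_norm X"
proof -
  obtain v where v: "norm v = 1" "norm (X *v v) = spectral_norm X" using spectral_norm_attained .
  obtain u where u: "norm u = 1" "X *v v = spectral_norm X *\<^sub>R u" using exists_unit_scaleR[of "X *v v"] v by metis
  then have "outer_H u v \<bullet> X = spectral_norm X" by (simp add: inner_outer_H norm_eq_1)
  moreover have "outer_H u v \<in> rank_one_units"
    unfolding rank_one_units_def using u v by (intro image_eqI[where x = "(u, v)"]) auto
  ultimately show ?thesis by blast
qed

text \<open>Danskin's theorem for a support function.\<close>

lemma GDERIV_support_function:
  fixes K :: "'a::euclidean_space set"
  assumes "compact K" and upper: "\<And>g y. g \<in> K \<Longrightarrow> g \<bullet> y \<le> f y"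
    and attained: "\<And>y. \<exists>g\<in>K. g \<bullet> y = f y"
    and g: "g \<in> K" "g \<bullet> x = f x" and unique: "\<And>g'. g' \<in> K \<Longrightarrow> g' \<bullet> x = f x \<Longrightarrow> g' = g"
  shows "GDERIV f x :> g"
proof -
  \<comment> \<open>\<open>p y\<close> is a chosen maximizer at \<open>y\<close>. Differentiability
    at \<open>x\<close> reduces to the continuity of this choice at \<open>x\<close>.\<close>
  obtain p where p: "\<And>y. p y \<in> K" "\<And>y. p y \<bullet> y = f y" using attained by metis
  have lim: "(p \<longlongrightarrow> g) (at x)"
  proof (rule tendstoI, rule ccontr)
    fix e :: real assume "e > 0" and "\<not> (\<forall>\<^sub>F y in at x. dist (p y) g < e)"
    then have "\<exists>y. y \<noteq> x \<and> dist y x < inverse (Suc n) \<and> e \<le> dist (p y) g" for n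
      using positive_imp_inverse_positive[of "real (Suc n)"] unfolding eventually_at not_less[symmetric]
      by (meson UNIV_I of_nat_0_less_iff zero_less_Suc)
    then obtain y where y: "\<And>n. dist (y n) x < inverse (Suc n)" "\<And>n. e \<le> dist (p (y n)) g"
      by metis
    have ylim: "y \<longlonglongrightarrow> x"
      unfolding tendsto_dist_iff[of y]
      by (rule tendsto_sandwich[OF _ _ tendsto_const LIMSEQ_inverse_real_of_nat])
        (use y(1) in \<open>auto intro!: always_eventually less_imp_le\<close>)
    obtain l r where l: "l \<in> K" "strict_mono r" "((\<lambda>n. p (y n)) \<circ> r) \<longlonglongrightarrow> l"
      using \<open>compact K\<close> p(1) unfolding compact_def by metis
    have yr: "(\<lambda>n. y (r n)) \<longlonglongrightarrow> x" using LIMSEQ_subseq_LIMSEQ[OF ylim l(2)] by (simp add: o_def)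
    \<comment> \<open>A limit of maximizers at \<open>y (r n)\<close> is a maximizer at
      \<open>x\<close>; uniqueness then identifies it with \<open>g\<close>, although the sequence
      stays at distance \<open>e\<close> from \<open>g\<close>.\<close>
    have "l \<bullet> x \<ge> g' \<bullet> x" if "g' \<in> K" for g'
    proof (rule LIMSEQ_le)
      show "(\<lambda>n. g' \<bullet> y (r n)) \<longlonglongrightarrow> g' \<bullet> x" by (intro tendsto_intros yr)
      show "(\<lambda>n. p (y (r n)) \<bullet> y (r n)) \<longlonglongrightarrow> l \<bullet> x"
        using l(3) by (intro tendsto_intros yr) (simp add: o_def)
      show "\<exists>N. \<forall>n\<ge>N. g' \<bullet> y (r n) \<le> p (y (r n)) \<bullet> y (r n)" using that upper p(2) by simp
    qed
    then have "l \<bullet> x = f x" using g upper[OF l(1), of x] by force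
    then have "l = g" using unique l(1) by blast
    then have "(\<lambda>n. dist (p (y (r n))) g) \<longlonglongrightarrow> 0"
      using l(3) by (simp add: o_def flip: tendsto_dist_iff)
    moreover have "e \<le> dist (p (y (r n))) g" for n using y(2) .
    ultimately have "e \<le> 0" by (meson LIMSEQ_le_const)
    then show False using \<open>e > 0\<close> by simp
  qed
  show ?thesis unfolding gderiv_def has_derivative_at_within
  proof (intro conjI bounded_linear_inner_left)
    have lim0: "((\<lambda>y. norm (p y - g)) \<longlongrightarrow> 0) (at x)" using lim by (simp add: tendsto_norm_zero_iff LIM_zero_iff)
    \<comment> \<open>The remainder lies between \<open>0\<close>, as \<open>g\<close> competes at
      \<open>y\<close>, and \<open>(p y - g) \<bullet> (y - x)\<close>, as \<open>p y\<close>
      competes at \<open>x\<close>.\<close>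
    have *: "norm ((f y - f x - (y - x) \<bullet> g) /\<^sub>R norm (y - x)) \<le> norm (p y - g)" for y
    proof (cases "y = x")
      case False
      have "0 \<le> f y - f x - (y - x) \<bullet> g"
        using upper[OF g(1), of y] g(2) by (simp add: inner_diff_right inner_commute inner_diff_left)
      moreover have "f y - f x - (y - x) \<bullet> g \<le> (p y - g) \<bullet> (y - x)"
        using upper[OF p(1)[of y], of x] p(2)[of y] g(2) by (simp add: inner_diff_right inner_diff_left inner_commute)
      moreover have "(p y - g) \<bullet> (y - x) \<le> norm (p y - g) * norm (y - x)" by (rule norm_cauchy_schwarz)
      ultimately have "\<bar>f y - f x - (y - x) \<bullet> g\<bar> \<le> norm (p y - g) * norm (y - x)" by linarith
      then show ?thesis using False by (simp add: divide_simps)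
    qed simp
    show "((\<lambda>y. (f y - f x - (y - x) \<bullet> g) /\<^sub>R norm (y - x)) \<longlongrightarrow> 0) (at x within UNIV)"
      by (rule Lim_null_comparison[OF always_eventually[OF allI[OF *]] lim0])
  qed
qed

text \<open>The matrices whose maximal singular value has multiplicity at least two. The condition
  uses norms instead of the dimension of \<open>singular_space\<close> because it has to pass to
  limits.\<close>

definition degenerate_top :: "(complex^'c^'r) set" where
  "degenerate_top = {X. \<exists>v w. norm v = 1 \<and> norm w = 1 \<and> hinner v w = 0 \<and>
     norm (X *v v) = spectral_norm X \<and> norm (X *v w) = spectral_norm X}"

text \<open>
  The attainment of the maximum is spelled out as a family of closed conditions on \<open>X\<close>, \<open>v\<close> and \<open>w\<close>,
  so that the set is the projection of a closed set along a compact one.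
\<close>

lemma degenerate_top_alt:
  "degenerate_top = {X :: complex^'c^'r. \<exists>p. p \<in> sphere 0 1 \<times> sphere 0 1 \<and>
     (p, X) \<in> {q. hinner (fst (fst q)) (snd (fst q)) = 0} \<inter>
       (\<Inter>z\<in>sphere 0 1. {q. norm (snd q *v z) \<le> norm (snd q *v fst (fst q))} \<inter>
        {q. norm (snd q *v z) \<le> norm (snd q *v snd (fst q))})}"
proof -
  have *: "norm (X *v v) = spectral_norm X \<longleftrightarrow> (\<forall>z\<in>sphere 0 1. norm (X *v z) \<le> norm (X *v v))"
    if "norm v = 1" for X :: "complex^'c^'r" and v
  proof
    assume "norm (X *v v) = spectral_norm X"
    then show "\<forall>z\<in>sphere 0 1. norm (X *v z) \<le> norm (X *v v)"
      using norm_matrix_vector_le_spectral_norm[of X] by (metis dist_0_norm mem_sphere mult.right_neutral)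
  next
    assume *: "\<forall>z\<in>sphere 0 1. norm (X *v z) \<le> norm (X *v v)"
    obtain z where "norm z = 1" "norm (X *v z) = spectral_norm X" using spectral_norm_attained .
    then show "norm (X *v v) = spectral_norm X"
      using * that norm_matrix_vector_le_spectral_norm[of X v] by force
  qed
  show ?thesis
    unfolding degenerate_top_def split_paired_Ex by (intro Collect_cong ex_cong1) (auto simp: *)
qed

lemma closed_degenerate_top: "closed (degenerate_top :: (complex^'c^'r) set)"
  unfolding degenerate_top_alt
proof (rule closed_compact_projection)
  show "compact (sphere 0 1 \<times> sphere 0 1 :: ((complex^'c) \<times> (complex^'c)) set)"
    by (intro compact_Times) auto
  show "closed ({q. hinner (fst (fst q)) (snd (fst q)) = 0} \<inter>
       (\<Inter>z\<in>sphere 0 1. {q. norm (snd q *v z) \<le> norm (snd q *v fst (fst q))} \<inter>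
        {q :: ((complex^'c) \<times> (complex^'c)) \<times> (complex^'c^'r). norm (snd q *v z) \<le> norm (snd q *v snd (fst q))}))"
    by (intro closed_Int closed_INT ballI closed_Collect_eq closed_Collect_le continuous_intros)
qed

text \<open>In a one-dimensional space \<open>v = c x\<close> and \<open>w = e x\<close>, so
  \<open>hinner v w\<close> is \<open>cnj c * e\<close> times the squared norm of \<open>x\<close>,
  which is nonzero for unit vectors \<open>v\<close> and \<open>w\<close>.\<close>

lemma simple_imp_not_degenerate_top:
  assumes "simple_singular_value X (spectral_norm X)"
  shows "X \<notin> degenerate_top"
proof
  assume "X \<in> degenerate_top"
  then obtain v w where vw: "norm v = 1" "norm w = 1" "hinner v w = 0"
    "norm (X *v v) = spectral_norm X" "norm (X *v w) = spectral_norm X"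
    by (auto simp: degenerate_top_def)
  let ?S = "singular_space X (spectral_norm X)"
  have mem: "v \<in> ?S" "w \<in> ?S"
    using vw top_singular_space[OF norm_matrix_vector_le_spectral_norm] by auto
  obtain B where B: "B \<subseteq> ?S" "?S \<subseteq> vec.span B" "card B = vec.dim ?S"
    using vec.basis_exists by metis
  then obtain x where "B = {x}" using assms card_1_singletonE by (metis simple_singular_value_def)
  then have "v \<in> range (\<lambda>k. k *s x)" "w \<in> range (\<lambda>k. k *s x)"
    using B(2) mem unfolding vec.span_singleton[symmetric] by blast+
  then obtain c e where ce: "v = c *s x" "w = e *s x" by blast
  have "cmod c \<noteq> 0" "cmod e \<noteq> 0" "norm x \<noteq> 0" using vw(1,2) unfolding ce norm_smult by force+
  then show False
    using vw(3) unfolding ce hinner_smult_left hinner_smult_right hinner_self by simp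
qed

text \<open>Since \<open>norm (X v)\<close> is at most the spectral norm, a maximal value of
  \<open>u \<bullet> X v\<close> is an equality case of Cauchy-Schwarz.\<close>

lemma top_maximizer:
  assumes "norm u = 1" "norm v = 1" "outer_H u v \<bullet> X = spectral_norm X"
  shows "X *v v = spectral_norm X *\<^sub>R u" "v \<in> singular_space X (spectral_norm X)"
proof -
  show eq: "X *v v = spectral_norm X *\<^sub>R u"
    using assms norm_matrix_vector_le_spectral_norm[of X v]
    by (intro eq_scaleR_if_inner_ge) (auto simp: inner_outer_H inner_commute[of "X *v v"])
  obtain z where "norm z = 1" "norm (X *v z) = spectral_norm X" using spectral_norm_attained .
  then have "spectral_norm X \<ge> 0" using norm_ge_zero by metis
  with eq assms have "norm (X *v v) = spectral_norm X" by simp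
  then show "v \<in> singular_space X (spectral_norm X)"
    using top_singular_space[OF norm_matrix_vector_le_spectral_norm] assms by blast
qed

text \<open>Singular vectors are determined only up to a common phase \<open>c\<close>, and this
  phase cancels in \<open>u v^H\<close>.\<close>

lemma unique_rank_one_maximizer:
  fixes X :: "complex^'c^'r"
  assumes "X \<noteq> 0" "X \<notin> degenerate_top" "G \<in> rank_one_units" "G' \<in> rank_one_units"
    "G \<bullet> X = spectral_norm X" "G' \<bullet> X = spectral_norm X"
  shows "G' = G"
proof -
  let ?\<sigma> = "spectral_norm X"
  obtain u v u' v' where G: "G = outer_H u v" "G' = outer_H u' v'"
    and n: "norm u = 1" "norm v = 1" "norm u' = 1" "norm v' = 1"
    using assms by (auto simp: rank_one_units_def)
  have \<sigma>: "?\<sigma> > 0" using assms spectral_norm_pos by blast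
  have X: "X *v v = ?\<sigma> *\<^sub>R u" "X *v v' = ?\<sigma> *\<^sub>R u'"
    and S: "v \<in> singular_space X ?\<sigma>" "v' \<in> singular_space X ?\<sigma>"
    using top_maximizer n assms G by metis+
  define c where "c = hinner v v'"
  \<comment> \<open>The part of \<open>v'\<close> orthogonal to \<open>v\<close> is again in the top
    singular space. If nonzero, its normalization together with \<open>v\<close> would make
    \<open>X\<close> degenerate.\<close>
  have "v' - c *s v = 0"
  proof (rule ccontr)
    let ?y = "v' - c *s v"
    let ?w = "complex_of_real (inverse (norm ?y)) *s ?y"
    assume "?y \<noteq> 0"
    moreover have "?y \<in> singular_space X ?\<sigma>" using S singular_space_smult singular_space_diff by blast
    ultimately have w: "?w \<in> singular_space X ?\<sigma>" "norm ?w = 1" using singular_space_unit by blast+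
    have "hinner v ?y = 0"
      using n by (simp add: hinner_diff_right hinner_smult_right hinner_self c_def)
    then have "hinner v ?w = 0" unfolding hinner_smult_right by simp
    moreover have "norm (X *v v) = ?\<sigma>" "norm (X *v ?w) = ?\<sigma>"
      using top_singular_space[OF norm_matrix_vector_le_spectral_norm] n S w by blast+
    ultimately have "X \<in> degenerate_top" using n w(2) unfolding degenerate_top_def by blast
    then show False using assms by blast
  qed
  then have v': "v' = c *s v" by simp
  then have "cmod c = 1" using n by (simp add: norm_smult)
  have "?\<sigma> *\<^sub>R u' = c *s (X *v v)"
    using X(2) unfolding v' vec.scale by simp
  also have "\<dots> = ?\<sigma> *\<^sub>R (c *s u)"
    unfolding X(1) by (simp add: vec_eq_iff)
  finally have "?\<sigma> *\<^sub>R u' = ?\<sigma> *\<^sub>R (c *s u)" .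
  \<comment> \<open>Positivity of the maximal singular value, that is \<open>X \<noteq> 0\<close>,
    transfers the phase from \<open>v\<close> to \<open>u\<close>.\<close>
  then have u': "u' = c *s u" using \<sigma> by simp
  have "c * cnj c = 1" unfolding complex_norm_square[symmetric] using \<open>cmod c = 1\<close> by simp
  then have "c * x * cnj (c * y) = x * cnj y" for x y
    by (metis complex_cnj_mult mult.assoc mult.commute mult_1)
  then show ?thesis
    unfolding G u' v' by (simp add: outer_H_def vec_eq_iff del: complex_cnj_mult)
qed

lemma GDERIV_spectral_norm:
  assumes "X \<noteq> 0" "X \<notin> degenerate_top" "norm u = 1" "norm v = 1"
    "outer_H u v \<bullet> X = spectral_norm X"
  shows "GDERIV spectral_norm X :> outer_H u v"
proof (rule GDERIV_support_function[OF compact_rank_one_units inner_rank_one_units_le spectral_norm_attained_rank_one])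
  show "outer_H u v \<in> rank_one_units"
    unfolding rank_one_units_def using assms by (intro image_eqI[where x = "(u, v)"]) auto
  then show "G = outer_H u v" if "G \<in> rank_one_units" "G \<bullet> X = spectral_norm X" for G
    using unique_rank_one_maximizer assms that by blast
qed (use assms in simp_all)

lemma spectral_norm_has_gradient:
  assumes "X \<noteq> 0" "X \<notin> degenerate_top"
  obtains G where "GDERIV spectral_norm X :> G"
proof -
  obtain u v where "norm u = 1" "norm v = 1" "outer_H u v \<bullet> X = spectral_norm X"
    using spectral_norm_attained_rank_one[of X] unfolding rank_one_units_def by auto
  from GDERIV_spectral_norm[OF assms this] show ?thesis by (rule that)
qed

section \<open>Derivative of the transfer function\<close>

lemma bounded_bilinear_matrix_mult:
  "bounded_bilinear ((**) :: 'a::{real_normed_algebra_1,euclidean_space}^'c^'r \<Rightarrow> 'a^'d^'c \<Rightarrow> 'a^'d^'r)"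
proof -
  have "bilinear ((**) :: 'a^'c^'r \<Rightarrow> 'a^'d^'c \<Rightarrow> 'a^'d^'r)"
    unfolding bilinear_def
    by (auto intro!: linearI simp: matrix_matrix_mult_def vec_eq_iff algebra_simps sum.distrib
        scaleR_sum_right)
  then show ?thesis by (simp add: bilinear_conv_bounded_bilinear)
qed

lemmas has_derivative_matrix_mult [derivative_intros] =
  bounded_bilinear.FDERIV[OF bounded_bilinear_matrix_mult]

lemma matrix_inv_inverse:
  assumes "invertible A"
  shows "A ** matrix_inv A = mat 1" "matrix_inv A ** A = mat 1"
  using assms someI_ex[of "\<lambda>B. A ** B = mat 1 \<and> B ** A = mat 1"]
  by (auto simp: invertible_def matrix_inv_def)

lemma matrix_diff_ldistrib: "A ** (B - C) = A ** B - A ** (C :: 'a::ring_1^'d^'c)"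
  and matrix_diff_rdistrib: "(A - A') ** B = A ** B - A' ** (B :: 'a::ring_1^'d^'c)"
  by (simp_all add: matrix_matrix_mult_def vec_eq_iff sum_subtractf algebra_simps)

text \<open>The resolvent identity, the source of both the continuity and the derivative of
  inversion.\<close>

lemma matrix_inv_diff:
  fixes A Y :: "'a::ring_1^'n^'n"
  assumes "invertible A" "invertible Y"
  shows "matrix_inv A - matrix_inv Y = matrix_inv A ** (Y - A) ** matrix_inv Y"
proof -
  have "matrix_inv A ** (Y - A) ** matrix_inv Y
      = matrix_inv A ** (Y ** matrix_inv Y) - matrix_inv A ** A ** matrix_inv Y"
    by (simp add: matrix_diff_ldistrib matrix_diff_rdistrib matrix_mul_assoc)
  then show ?thesis by (simp add: matrix_inv_inverse assms matrix_mul_lid matrix_mul_rid)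
qed

text \<open>The determinant is a polynomial in the entries, hence continuous.\<close>

lemma open_invertible: "open {A :: complex^'n^'n. invertible A}"
  unfolding invertible_det_nz det_def
  by (intro open_Collect_neq continuous_intros)

text \<open>The resolvent identity bounds the difference of the inverses by a multiple of
  \<open>norm (Y - A) * norm (matrix_inv Y)\<close>; what remains is to bound
  \<open>matrix_inv Y\<close> near \<open>A\<close>.\<close>

lemma tendsto_matrix_inv:
  fixes A :: "complex^'n^'n"
  assumes A: "invertible A"
  shows "(matrix_inv \<longlongrightarrow> matrix_inv A) (at A within {Y. invertible Y})"
proof -
  let ?F = "at A within {Y. invertible Y}"
  obtain K where "K > 0" and K: "\<And>(B :: complex^'n^'n) (C :: complex^'n^'n). norm (B ** C) \<le> norm B * norm C * K"
    using bounded_bilinear.pos_bounded[OF bounded_bilinear_matrix_mult] by blast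
  define c where "c = K * K * norm (matrix_inv A)"
  have diff: "norm (matrix_inv A - matrix_inv Y) \<le> c * norm (Y - A) * norm (matrix_inv Y)"
    if "invertible Y" for Y
  proof -
    have "norm (matrix_inv A - matrix_inv Y) \<le> norm (matrix_inv A ** (Y - A)) * norm (matrix_inv Y) * K"
      unfolding matrix_inv_diff[OF A that] by (rule K)
    also have "\<dots> \<le> (norm (matrix_inv A) * norm (Y - A) * K) * norm (matrix_inv Y) * K"
      using \<open>K > 0\<close> by (intro mult_right_mono K) auto
    finally show ?thesis by (simp add: c_def mult_ac)
  qed
  have lim: "((\<lambda>Y. c * norm (Y - A)) \<longlongrightarrow> 0) ?F"
    by (intro tendsto_eq_intros | simp)+
  have inv: "\<forall>\<^sub>F Y in ?F. invertible Y" by (simp add: eventually_at_filter)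
  have "\<forall>\<^sub>F Y in ?F. c * norm (Y - A) < 1 / 2" using order_tendstoD(2)[OF lim, of "1 / 2"] by simp
  then have "\<forall>\<^sub>F Y in ?F. norm (matrix_inv Y - matrix_inv A) \<le> c * norm (Y - A) * (2 * norm (matrix_inv A))"
    using inv
  proof eventually_elim
    case (elim Y)
    have "c \<ge> 0" using \<open>K > 0\<close> by (simp add: c_def)
    \<comment> \<open>Where \<open>c * norm (Y - A) < 1 / 2\<close>, half of
      \<open>norm (matrix_inv Y)\<close> can be absorbed on the left.\<close>
    have "norm (matrix_inv Y) \<le> norm (matrix_inv A) + norm (matrix_inv A - matrix_inv Y)"
      by (rule norm_triangle_sub[of "matrix_inv Y" "matrix_inv A", unfolded norm_minus_commute[of "matrix_inv Y"]])
    also have "\<dots> \<le> norm (matrix_inv A) + 1 / 2 * norm (matrix_inv Y)"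
      using diff[OF elim(2)] mult_right_mono[of "c * norm (Y - A)" "1 / 2" "norm (matrix_inv Y)"] elim(1) by simp
    finally have "norm (matrix_inv Y) \<le> 2 * norm (matrix_inv A)" by simp
    then have "c * norm (Y - A) * norm (matrix_inv Y) \<le> c * norm (Y - A) * (2 * norm (matrix_inv A))"
      using \<open>c \<ge> 0\<close> by (intro mult_left_mono) auto
    then show ?case using diff[OF elim(2)] by (simp add: norm_minus_commute)
  qed
  moreover have "((\<lambda>Y. c * norm (Y - A) * (2 * norm (matrix_inv A))) \<longlongrightarrow> 0) ?F"
    using tendsto_mult_left_zero[OF lim] .
  ultimately have "((\<lambda>Y. matrix_inv Y - matrix_inv A) \<longlongrightarrow> 0) ?F" by (rule Lim_null_comparison)
  then show ?thesis by (simp add: LIM_zero_iff)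
qed

lemma has_derivative_matrix_inv_at:
  fixes A :: "complex^'n^'n"
  assumes A: "invertible A"
  shows "(matrix_inv has_derivative (\<lambda>h. - (matrix_inv A ** h ** matrix_inv A))) (at A)"
proof -
  let ?C = "matrix_inv A"
  obtain K where "K > 0" and K: "\<And>(B :: complex^'n^'n) (C :: complex^'n^'n). norm (B ** C) \<le> norm B * norm C * K"
    using bounded_bilinear.pos_bounded[OF bounded_bilinear_matrix_mult] by blast
  have "(matrix_inv has_derivative (\<lambda>h. - (?C ** h ** ?C))) (at A within {Y. invertible Y})"
  \<comment> \<open>The radius is arbitrary: the estimate holds at every invertible
    \<open>Y \<noteq> A\<close>.\<close>
  proof (rule has_derivativeI_sandwich[where e = 1 and H = "\<lambda>Y. K * K * norm ?C * norm (matrix_inv Y - ?C)"])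
    have "bounded_linear (\<lambda>h. ?C ** h ** ?C)"
      by (intro bounded_linear_compose[OF bounded_bilinear.bounded_linear_left[OF bounded_bilinear_matrix_mult]
            bounded_bilinear.bounded_linear_right[OF bounded_bilinear_matrix_mult]])
    then show "bounded_linear (\<lambda>h. - (?C ** h ** ?C))" by (rule bounded_linear_minus)
    have "((\<lambda>Y. norm (matrix_inv Y - ?C)) \<longlongrightarrow> 0) (at A within {Y. invertible Y})"
      using tendsto_matrix_inv[OF A] by (simp add: tendsto_norm_zero_iff LIM_zero_iff)
    then show "((\<lambda>Y. K * K * norm ?C * norm (matrix_inv Y - ?C)) \<longlongrightarrow> 0) (at A within {Y. invertible Y})"
      by (rule tendsto_mult_right_zero)
  next
    fix Y :: "complex^'n^'n" assume Y: "Y \<in> {Y. invertible Y}" "Y \<noteq> A"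
    then have iY: "invertible Y" by simp
    \<comment> \<open>Applying the resolvent identity once more shows that the remainder has the two
      small factors \<open>Y - A\<close> and \<open>?C - matrix_inv Y\<close>.\<close>
    have "matrix_inv Y - ?C - - (?C ** (Y - A) ** ?C) = ?C ** (Y - A) ** (?C - matrix_inv Y)"
      by (simp add: matrix_diff_ldistrib[of "?C ** (Y - A)"] flip: matrix_inv_diff[OF A iY])
    then have "norm (matrix_inv Y - ?C - - (?C ** (Y - A) ** ?C)) \<le> norm (?C ** (Y - A)) * norm (matrix_inv Y - ?C) * K"
      using K by (simp add: norm_minus_commute)
    also have "\<dots> \<le> (norm ?C * norm (Y - A) * K) * norm (matrix_inv Y - ?C) * K"
      using \<open>K > 0\<close> by (intro mult_right_mono K) auto
    finally show "norm (matrix_inv Y - ?C - - (?C ** (Y - A) ** ?C)) / norm (Y - A)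
        \<le> K * K * norm ?C * norm (matrix_inv Y - ?C)"
      using Y(2) by (simp add: divide_simps mult_ac)
  qed simp
  \<comment> \<open>The invertible matrices form an open set, so restricting to them does not change
    the derivative at \<open>A\<close>.\<close>
  then show ?thesis using at_within_open[OF _ open_invertible, of A] A by simp
qed

lemma has_derivative_matrix_inv [derivative_intros]:
  fixes f :: "'a::real_normed_vector \<Rightarrow> complex^'n^'n"
  assumes "(f has_derivative f') (at x within S)" "invertible (f x)"
  shows "((\<lambda>x. matrix_inv (f x)) has_derivative
    (\<lambda>h. - (matrix_inv (f x) ** f' h ** matrix_inv (f x)))) (at x within S)"
  using has_derivative_compose[OF assms(1) has_derivative_matrix_inv_at[OF assms(2)]] .

section \<open>Linear operations and the product rule for the transfer function\<close>

lemma has_derivative_linear: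
  fixes L :: "'a::euclidean_space \<Rightarrow> 'b::real_normed_vector"
  assumes "linear L" "(f has_derivative f') F"
  shows "((\<lambda>x. L (f x)) has_derivative (\<lambda>h. L (f' h))) F"
  using assms by (simp add: bounded_linear.has_derivative linear_conv_bounded_linear)

lemma linear_cmat: "linear cmat"
  by (auto intro!: linearI simp: map_matrix_def vec_eq_iff scaleR_conv_of_real[where 'a = complex])

lemma linear_smult_mat: "linear (smult_mat c)"
  by (auto intro!: linearI simp: map_matrix_def vec_eq_iff algebra_simps)

lemma linear_transpose: "linear (transpose :: 'a::real_vector^'c^'r \<Rightarrow> 'a^'r^'c)"
  by (auto intro!: linearI simp: transpose_def vec_eq_iff)

text \<open>Taking a block is a linear map of the whole matrix, so it commutes with differentiation
  of \<open>pH_W\<close>; the same purpose is served by \<open>block_P\<close> and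
  \<open>block_S\<close>.\<close>

definition block_R :: "'a^('n::finite + 'm::finite)^('n + 'm) \<Rightarrow> 'a^'n^'n" where
  "block_R W = (\<chi> i j. W $ Inl i $ Inl j)"

definition block_P :: "'a^('n::finite + 'm::finite)^('n + 'm) \<Rightarrow> 'a^'m^'n" where
  "block_P W = (\<chi> i j. W $ Inl i $ Inr j)"

definition block_S :: "'a^('n::finite + 'm::finite)^('n + 'm) \<Rightarrow> 'a^'m^'m" where
  "block_S W = (\<chi> i j. W $ Inr i $ Inr j)"

lemma linear_block_R: "linear (block_R :: 'a::real_vector^('n::finite + 'm::finite)^('n + 'm) \<Rightarrow> 'a^'n^'n)"
  and linear_block_P: "linear (block_P :: 'a::real_vector^('n::finite + 'm::finite)^('n + 'm) \<Rightarrow> 'a^'m^'n)"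
  and linear_block_S: "linear (block_S :: 'a::real_vector^('n::finite + 'm::finite)^('n + 'm) \<Rightarrow> 'a^'m^'m)"
  by (auto intro!: linearI simp: block_R_def block_P_def block_S_def vec_eq_iff)

lemma pH_blocks:
  "pH_R d \<theta> = block_R (pH_W d \<theta>)" "pH_P d \<theta> = block_P (pH_W d \<theta>)" "pH_S d \<theta> = block_S (pH_W d \<theta>)"
  by (simp_all add: pH_R_def pH_P_def pH_S_def block_R_def block_P_def block_S_def)

lemma has_derivative_pH_pencil:
  assumes "(pH_E d has_derivative E') (at \<theta>)" "(pH_J d has_derivative J') (at \<theta>)"
    "(pH_W d has_derivative W') (at \<theta>)"
  shows "(pH_pencil d s has_derivative
    (\<lambda>h. smult_mat s (cmat (E' h)) - cmat (J' h - block_R (W' h)))) (at \<theta>)"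
  unfolding pH_pencil_def[abs_def] pH_blocks
  by (intro derivative_intros assms has_derivative_linear[OF linear_cmat] has_derivative_linear[OF linear_smult_mat]
      has_derivative_linear[OF linear_block_R])

text \<open>The product rule is applied twice to the left-associated triple product, which explains
  the nesting of the terms; the inner derivative is that of the inverse of the pencil.\<close>

lemma has_derivative_H_pH:
  assumes "(pH_E d has_derivative E') (at \<theta>)" "(pH_J d has_derivative J') (at \<theta>)"
    and W: "(pH_W d has_derivative W') (at \<theta>)" "(pH_B d has_derivative B') (at \<theta>)" "(pH_N d has_derivative N') (at \<theta>)"
    and inv: "invertible (pH_pencil d s \<theta>)"
  defines "D' \<equiv> \<lambda>h. smult_mat s (cmat (E' h)) - cmat (J' h - block_R (W' h))"
  shows "(H_pH d s has_derivative (\<lambda>h.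
      cmat (transpose (pH_B d \<theta> + pH_P d \<theta>)) ** matrix_inv (pH_pencil d s \<theta>) ** cmat (B' h - block_P (W' h))
      + (cmat (transpose (pH_B d \<theta> + pH_P d \<theta>)) **
          - (matrix_inv (pH_pencil d s \<theta>) ** D' h ** matrix_inv (pH_pencil d s \<theta>))
        + cmat (transpose (B' h + block_P (W' h))) ** matrix_inv (pH_pencil d s \<theta>)) ** cmat (pH_B d \<theta> - pH_P d \<theta>)
      + cmat (block_S (W' h)) + cmat (N' h))) (at \<theta>)"
  unfolding H_pH_def[abs_def] pH_blocks D'_def
  by (intro derivative_intros assms has_derivative_linear[OF linear_cmat] has_derivative_linear[OF linear_transpose]
      has_derivative_linear[OF linear_block_P] has_derivative_linear[OF linear_block_S]
      has_derivative_pH_pencil)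

section \<open>Reshaping functions are adjoint to each other\<close>

lemma length_idxs: "length (idxs :: 'k::{finite,linorder} list) = CARD('k)"
  by simp

text \<open>The list \<open>idxs\<close> is strictly increasing, so exactly the first
  \<open>p\<close> of its elements lie below the one at index \<open>p\<close>.\<close>

lemma pos_idxs_nth:
  assumes "p < CARD('k::{finite,linorder})"
  shows "pos (idxs ! p :: 'k) = p"
proof -
  let ?e = "\<lambda>q. idxs ! q :: 'k"
  have less: "?e q < ?e r \<longleftrightarrow> q < r" if "q < CARD('k)" "r < CARD('k)" for q r
  proof -
    have mono: "?e q < ?e r" if "q < r" "r < CARD('k)" for q r
      using sorted_wrt_nth_less[OF strict_sorted_list_of_set that(1)] that(2) by simp
    then show ?thesis using that by (metis linorder_neqE_nat order_less_asym)
  qed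
  have "{j :: 'k. j < ?e p} = ?e ` {..<p}"
  proof (intro equalityI subsetI)
    fix j :: 'k assume j: "j \<in> {j. j < ?e p}"
    have "j \<in> set idxs" by simp
    then obtain q where "q < CARD('k)" "j = ?e q" unfolding in_set_conv_nth length_idxs by metis
    then show "j \<in> ?e ` {..<p}" using j less assms by auto
  next
    fix j assume "j \<in> ?e ` {..<p}"
    then show "j \<in> {j. j < ?e p}" using less assms by auto
  qed
  moreover have "inj_on ?e {..<p}"
  proof (rule inj_onI)
    fix q r assume "q \<in> {..<p}" "r \<in> {..<p}" "?e q = ?e r"
    then show "q = r" using less[of q r] less[of r q] assms by auto
  qed
  ultimately show ?thesis by (simp add: pos_def card_image)
qed

lemma pos_less_card: "pos (i :: 'k::{finite,linorder}) < CARD('k)"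
  unfolding pos_def by (rule psubset_card_mono) auto

lemma pos_strict_mono: "i < j \<Longrightarrow> pos (i :: 'k::{finite,linorder}) < pos j"
  unfolding pos_def by (rule psubset_card_mono) auto

lemma pos_less_iff: "pos (i :: 'k::{finite,linorder}) < pos j \<longleftrightarrow> i < j"
  by (metis pos_strict_mono linorder_less_linear order_less_asym)

lemma pos_le_iff: "pos (i :: 'k::{finite,linorder}) \<le> pos j \<longleftrightarrow> i \<le> j"
  by (meson pos_less_iff not_less)

lemma map_idxs: "map f (idxs :: 'k::{finite,linorder} list) = map (\<lambda>p. f (idxs ! p)) [0..<CARD('k)]"
  by (rule nth_equalityI) simp_all

lemma sum_list_idxs: "sum_list (map f (idxs :: 'k::{finite,linorder} list)) = sum f UNIV"
  by (simp add: sum_list_distinct_conv_sum_set)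

lemma sum_UNIV_idxs: "sum f (UNIV :: 'k::{finite,linorder} set) = (\<Sum>p<CARD('k). f (idxs ! p))"
  unfolding sum_list_idxs[symmetric] map_idxs by (simp add: interv_sum_list_conv_sum_set_nat atLeast0LessThan)

text \<open>Windows of lengths \<open>c 0\<close>, \<open>c 1\<close>, ... that start at the partial
  sums are adjacent and tile an initial segment of \<open>w\<close>.\<close>

lemma concat_map_nth_blocks:
  "concat (map (\<lambda>p. map (\<lambda>q. w ! ((\<Sum>r<p. c r) + q)) [0..<c p]) [0..<k]) = map ((!) w) [0..<\<Sum>r<k. c r]"
proof (induction k)
  case (Suc k)
  have "map (\<lambda>q. w ! ((\<Sum>r<k. c r) + q)) [0..<c k] = map ((!) w) [\<Sum>r<k. c r..<(\<Sum>r<k. c r) + c k]"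
    by (rule nth_equalityI) auto
  then show ?case using Suc by (simp add: upt_add_eq_append[of 0])
qed simp

text \<open>This describes one row of a triangle: columns before \<open>a\<close> contribute
  nothing, and the others are counted from \<open>a\<close>.\<close>

lemma concat_map_if_ge:
  "concat (map (\<lambda>p. if a \<le> p then [f (p - a)] else []) [0..<k]) = map f [0..<k - a]"
  by (induction k) (auto simp: Suc_diff_le)

lemma sum_diff_lessThan: "(\<Sum>r<k. k - r) = k * (k + 1) div (2 :: nat)"
proof (induction k)
  case (Suc k)
  then show ?case by (subst sum.lessThan_Suc_shift) simp
qed simp

lemma sum_diff1_lessThan: "(\<Sum>r<k. k - 1 - r) = k * (k - 1) div (2 :: nat)"
proof (cases k)
  case (Suc l)
  then show ?thesis using sum_diff_lessThan[of l] by (simp add: mult.commute)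
qed simp

lemma block_index_less:
  fixes c :: "nat \<Rightarrow> nat"
  assumes "p < k" "q < c p"
  shows "(\<Sum>r<p. c r) + q < (\<Sum>r<k. c r)"
proof -
  have "(\<Sum>r<Suc p. c r) \<le> (\<Sum>r<k. c r)" using assms by (intro sum_mono2) auto
  then show ?thesis using assms by simp
qed

text \<open>Row \<open>i\<close> read from the diagonal onwards is the window of \<open>w\<close>
  that starts after all previous rows, and these windows tile \<open>w\<close>.\<close>

lemma utv_vtu:
  assumes "length w = CARD('k::{finite,linorder}) * (CARD('k::{finite,linorder}) + 1) div 2"
  shows "utv (vtu w :: 'a::zero^'k::{finite,linorder}^'k::{finite,linorder}) = w"
proof -
  let ?c = "\<lambda>p. CARD('k) - p"
  have row: "concat (map (\<lambda>j. if i \<le> j then [(vtu w :: 'a^'k::{finite,linorder}^'k::{finite,linorder}) $ i $ j] else []) idxs)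
      = map (\<lambda>q. w ! ((\<Sum>r<pos i. ?c r) + q)) [0..<?c (pos i)]" for i :: 'k
  proof -
    have "map (\<lambda>j. if i \<le> j then [(vtu w :: 'a^'k::{finite,linorder}^'k::{finite,linorder}) $ i $ j] else []) idxs =
      map (\<lambda>p. if pos i \<le> p then [w ! ((\<Sum>r<pos i. ?c r) + (p - pos i))] else []) [0..<CARD('k)]"
      unfolding map_idxs by (rule map_cong) (auto simp: vtu_def pos_idxs_nth simp flip: pos_le_iff)
    then show ?thesis
      using concat_map_if_ge[of "pos i" "\<lambda>q. w ! ((\<Sum>r<pos i. ?c r) + q)" "CARD('k)"] by simp
  qed
  have "utv (vtu w :: 'a^'k::{finite,linorder}^'k::{finite,linorder}) =
      concat (map (\<lambda>p. map (\<lambda>q. w ! ((\<Sum>r<p. ?c r) + q)) [0..<?c p]) [0..<CARD('k)])"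
    unfolding utv_def row unfolding map_idxs by (rule arg_cong[of _ _ concat], rule map_cong) (auto simp: pos_idxs_nth)
  then show ?thesis
    using map_nth[of w] unfolding concat_map_nth_blocks sum_diff_lessThan assms by simp
qed

lemma sutv_vtsu:
  assumes "length w = CARD('k::{finite,linorder}) * (CARD('k::{finite,linorder}) - 1) div 2"
  shows "sutv (vtsu w :: 'a::zero^'k::{finite,linorder}^'k::{finite,linorder}) = w"
proof -
  let ?c = "\<lambda>p. CARD('k) - 1 - p"
  have row: "concat (map (\<lambda>j. if i < j then [(vtsu w :: 'a^'k::{finite,linorder}^'k::{finite,linorder}) $ i $ j] else []) idxs)
      = map (\<lambda>q. w ! ((\<Sum>r<pos i. ?c r) + q)) [0..<?c (pos i)]" for i :: 'k
  proof -
    \<comment> \<open>Rows now start one column to the right of the diagonal, hence the cut at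
      \<open>Suc (pos i)\<close>.\<close>
    have "map (\<lambda>j. if i < j then [(vtsu w :: 'a^'k::{finite,linorder}^'k::{finite,linorder}) $ i $ j] else []) idxs =
      map (\<lambda>p. if Suc (pos i) \<le> p then [w ! ((\<Sum>r<pos i. ?c r) + (p - Suc (pos i)))] else []) [0..<CARD('k)]"
      unfolding map_idxs by (rule map_cong) (auto simp: vtsu_def pos_idxs_nth Suc_le_eq simp flip: pos_less_iff)
    then show ?thesis
      using concat_map_if_ge[of "Suc (pos i)" "\<lambda>q. w ! ((\<Sum>r<pos i. ?c r) + q)" "CARD('k)"] by simp
  qed
  have "sutv (vtsu w :: 'a^'k::{finite,linorder}^'k::{finite,linorder}) =
      concat (map (\<lambda>p. map (\<lambda>q. w ! ((\<Sum>r<p. ?c r) + q)) [0..<?c p]) [0..<CARD('k)])"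
    unfolding sutv_def row unfolding map_idxs by (rule arg_cong[of _ _ concat], rule map_cong) (auto simp: pos_idxs_nth)
  then show ?thesis
    using map_nth[of w] unfolding concat_map_nth_blocks sum_diff1_lessThan assms by simp
qed

lemma vec_cols_vtf:
  assumes "length w = CARD('r::{finite,linorder}) * CARD('c::{finite,linorder})"
  shows "vec_cols (vtf w :: 'a^'c::{finite,linorder}^'r::{finite,linorder}) = w"
proof -
  let ?c = "\<lambda>_::nat. CARD('r)"
  have "vec_cols (vtf w :: 'a^'c::{finite,linorder}^'r::{finite,linorder}) =
      concat (map (\<lambda>p. map (\<lambda>q. w ! ((\<Sum>r<p. ?c r) + q)) [0..<?c p]) [0..<CARD('c)])"
    unfolding vec_cols_def map_idxs
    by (rule arg_cong[of _ _ concat], rule map_cong) (auto simp: pos_idxs_nth vtf_def)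
  then show ?thesis
    using map_nth[of w] unfolding concat_map_nth_blocks using assms by (simp add: mult.commute)
qed

text \<open>Lists of parameters carry no vector space structure, so linearity is required entry by
  entry, and only for indices inside the triangle.\<close>

lemma linear_vtu:
  assumes "\<And>k. k < CARD('k::{finite,linorder}) * (CARD('k::{finite,linorder}) + 1) div 2 \<Longrightarrow> linear (\<lambda>x. L x ! k)"
  shows "linear (\<lambda>x. vtu (L x) :: real^'k::{finite,linorder}^'k::{finite,linorder})"
proof -
  have "linear (\<lambda>x. L x ! ((\<Sum>p<pos i. CARD('k) - p) + (pos j - pos i)))" if "i \<le> j" for i j :: 'k
  proof (rule assms)
    have "pos j - pos i < CARD('k) - pos i"
      using pos_less_card[of j] that[folded pos_le_iff] by linarith
    then show "(\<Sum>p<pos i. CARD('k) - p) + (pos j - pos i) < CARD('k) * (CARD('k) + 1) div 2"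
      unfolding sum_diff_lessThan[symmetric] by (intro block_index_less pos_less_card)
  qed
  from linear_add[OF this] linear_cmul[OF this] show ?thesis
    by (intro linearI) (auto simp: vtu_def vec_eq_iff)
qed

lemma linear_vtsu:
  assumes "\<And>k. k < CARD('k::{finite,linorder}) * (CARD('k::{finite,linorder}) - 1) div 2 \<Longrightarrow> linear (\<lambda>x. L x ! k)"
  shows "linear (\<lambda>x. vtsu (L x) :: real^'k::{finite,linorder}^'k::{finite,linorder})"
proof -
  have "linear (\<lambda>x. L x ! ((\<Sum>p<pos i. CARD('k) - 1 - p) + (pos j - pos i - 1)))" if "i < j" for i j :: 'k
  proof (rule assms)
    have "pos j - pos i - 1 < CARD('k) - 1 - pos i"
      using pos_less_card[of j] pos_strict_mono[OF that] by linarith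
    then show "(\<Sum>p<pos i. CARD('k) - 1 - p) + (pos j - pos i - 1) < CARD('k) * (CARD('k) - 1) div 2"
      unfolding sum_diff1_lessThan[symmetric] by (intro block_index_less pos_less_card)
  qed
  from linear_add[OF this] linear_cmul[OF this] show ?thesis
    by (intro linearI) (auto simp: vtsu_def vec_eq_iff)
qed

lemma linear_vtf:
  assumes "\<And>k. k < CARD('r::{finite,linorder}) * CARD('c::{finite,linorder}) \<Longrightarrow> linear (\<lambda>x. L x ! k)"
  shows "linear (\<lambda>x. vtf (L x) :: real^'c::{finite,linorder}^'r::{finite,linorder})"
proof -
  have "linear (\<lambda>x. L x ! (pos j * CARD('r) + pos i))" for i :: 'r and j :: 'c
    using assms block_index_less[of "pos j" "CARD('c)" "pos i" "\<lambda>_. CARD('r)"]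
    by (simp add: pos_less_card mult.commute)
  from linear_add[OF this] linear_cmul[OF this] show ?thesis
    by (intro linearI) (auto simp: vtf_def vec_eq_iff)
qed

section \<open>Inner products of lists and of matrices\<close>

definition dot_list :: "real list \<Rightarrow> real list \<Rightarrow> real" where
  "dot_list xs ys = sum_list (map2 (*) xs ys)"

lemma dot_list_append_right:
  "dot_list xs (ys @ zs) = dot_list (take (length ys) xs) ys + dot_list (drop (length ys) xs) zs"
  by (simp add: dot_list_def zip_append2)

lemma dot_list_concat_map:
  assumes "\<And>x. x \<in> set xs \<Longrightarrow> length (f x) = length (g x)"
  shows "dot_list (concat (map f xs)) (concat (map g xs)) = (\<Sum>x\<leftarrow>xs. dot_list (f x) (g x))"
  using assms by (induction xs) (auto simp: dot_list_def)

lemma dot_list_vec_to_list: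
  fixes h :: "real^'p::{finite,linorder}"
  assumes "length xs = CARD('p::{finite,linorder})"
  shows "dot_list (vec_to_list h) xs = h \<bullet> list_to_vec xs"
proof -
  have "map2 (*) (vec_to_list h) xs = map (\<lambda>p. h $ (idxs ! p) * xs ! p) [0..<CARD('p)]"
    using assms by (intro nth_equalityI) (auto simp: vec_to_list_def)
  then have "dot_list (vec_to_list h) xs = (\<Sum>p<CARD('p). h $ (idxs ! p) * xs ! p)"
    by (simp add: dot_list_def interv_sum_list_conv_sum_set_nat atLeast0LessThan)
  also have "\<dots> = h \<bullet> list_to_vec xs"
    unfolding inner_vec_def sum_UNIV_idxs by (intro sum.cong) (auto simp: list_to_vec_def pos_idxs_nth)
  finally show ?thesis .
qed

definition mat_dot :: "real^'c^'r \<Rightarrow> real^'c^'r \<Rightarrow> real" where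
  "mat_dot A B = (\<Sum>i\<in>UNIV. \<Sum>j\<in>UNIV. A $ i $ j * B $ i $ j)"

text \<open>Writing \<open>w\<close> as \<open>utv (vtu w)\<close> lets both lists run through the
  triangle in the same order. The sum extends to all entries because \<open>vtu w\<close> vanishes
  below the diagonal.\<close>

lemma dot_list_utv:
  assumes "length w = CARD('k::{finite,linorder}) * (CARD('k::{finite,linorder}) + 1) div 2"
  shows "dot_list w (utv A) = mat_dot (vtu w) (A :: real^'k::{finite,linorder}^'k::{finite,linorder})"
proof -
  have "dot_list w (utv A) = dot_list (utv (vtu w :: real^'k::{finite,linorder}^'k::{finite,linorder})) (utv A)"
    by (simp add: utv_vtu[OF assms])
  also have "\<dots> = (\<Sum>i\<in>UNIV. \<Sum>j\<in>UNIV. if i \<le> j then (vtu w :: real^'k::{finite,linorder}^'k::{finite,linorder}) $ i $ j * A $ i $ j else 0)"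
    unfolding utv_def
    by (subst dot_list_concat_map, simp add: length_concat comp_def if_distrib[of length] cong: if_cong)
      (subst dot_list_concat_map, auto simp: sum_list_idxs dot_list_def intro!: sum.cong)
  also have "\<dots> = mat_dot (vtu w) A"
    unfolding mat_dot_def by (intro sum.cong) (auto simp: vtu_def)
  finally show ?thesis .
qed

lemma dot_list_sutv:
  assumes "length w = CARD('k::{finite,linorder}) * (CARD('k::{finite,linorder}) - 1) div 2"
  shows "dot_list w (sutv A) = mat_dot (vtsu w) (A :: real^'k::{finite,linorder}^'k::{finite,linorder})"
proof -
  have "dot_list w (sutv A) = dot_list (sutv (vtsu w :: real^'k::{finite,linorder}^'k::{finite,linorder})) (sutv A)"
    by (simp add: sutv_vtsu[OF assms])
  also have "\<dots> = (\<Sum>i\<in>UNIV. \<Sum>j\<in>UNIV. if i < j then (vtsu w :: real^'k::{finite,linorder}^'k::{finite,linorder}) $ i $ j * A $ i $ j else 0)"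
    unfolding sutv_def
    by (subst dot_list_concat_map, simp add: length_concat comp_def if_distrib[of length] cong: if_cong)
      (subst dot_list_concat_map, auto simp: sum_list_idxs dot_list_def intro!: sum.cong)
  also have "\<dots> = mat_dot (vtsu w) A"
    unfolding mat_dot_def by (intro sum.cong) (auto simp: vtsu_def)
  finally show ?thesis .
qed

lemma dot_list_vec_cols:
  assumes "length w = CARD('r::{finite,linorder}) * CARD('c::{finite,linorder})"
  shows "dot_list w (vec_cols A) = mat_dot (vtf w) (A :: real^'c::{finite,linorder}^'r::{finite,linorder})"
proof -
  have "dot_list w (vec_cols A) = dot_list (vec_cols (vtf w :: real^'c::{finite,linorder}^'r::{finite,linorder})) (vec_cols A)"
    by (simp add: vec_cols_vtf[OF assms])
  also have "\<dots> = (\<Sum>j\<in>UNIV. \<Sum>i\<in>UNIV. (vtf w :: real^'c::{finite,linorder}^'r::{finite,linorder}) $ i $ j * A $ i $ j)"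
    unfolding vec_cols_def
    by (subst dot_list_concat_map) (auto simp: sum_list_idxs dot_list_def zip_map_map zip_same_conv_map comp_def)
  also have "\<dots> = mat_dot (vtf w) A"
    unfolding mat_dot_def by (rule sum.swap)
  finally show ?thesis .
qed

text \<open>The length depends only on the shape of the matrix, so it may be computed for
  \<open>vtu\<close> of a list of zeros, where \<open>utv_vtu\<close> gives it.\<close>

lemma length_utv: "length (utv (A :: 'a::zero^'k::{finite,linorder}^'k::{finite,linorder})) = CARD('k) * (CARD('k) + 1) div 2"
proof -
  have "length (utv A) = length (utv (vtu (replicate (CARD('k) * (CARD('k) + 1) div 2) 0) :: 'a^'k::{finite,linorder}^'k::{finite,linorder}))"
    by (simp add: utv_def length_concat comp_def if_distrib[of length] cong: if_cong)
  then show ?thesis by (simp add: utv_vtu)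
qed

lemma length_sutv: "length (sutv (A :: 'a::zero^'k::{finite,linorder}^'k::{finite,linorder})) = CARD('k) * (CARD('k) - 1) div 2"
proof -
  have "length (sutv A) = length (sutv (vtsu (replicate (CARD('k) * (CARD('k) - 1) div 2) 0) :: 'a^'k::{finite,linorder}^'k::{finite,linorder}))"
    by (simp add: sutv_def length_concat comp_def if_distrib[of length] cong: if_cong)
  then show ?thesis by (simp add: sutv_vtsu)
qed

lemma length_vec_cols: "length (vec_cols (A :: 'a^'c::{finite,linorder}^'r::{finite,linorder})) = CARD('r) * CARD('c)"
  by (simp add: vec_cols_def length_concat comp_def sum_list_triv)

lemma map_utv: "map f (utv A) = utv (map_matrix f A)"
  by (simp add: utv_def map_concat comp_def if_distrib[of "map f"] map_matrix_def cong: if_cong)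

lemma map_sutv: "map f (sutv A) = sutv (map_matrix f A)"
  by (simp add: sutv_def map_concat comp_def if_distrib[of "map f"] map_matrix_def cong: if_cong)

lemma map_vec_cols: "map f (vec_cols A) = vec_cols (map_matrix f A)"
  by (simp add: vec_cols_def map_concat comp_def map_matrix_def)

section \<open>The gradient\<close>

definition trace_mult :: "complex^'c^'r \<Rightarrow> complex^'r^'c \<Rightarrow> complex" where
  "trace_mult A K = (\<Sum>i\<in>UNIV. \<Sum>j\<in>UNIV. A $ i $ j * K $ j $ i)"

text \<open>The bilinear Frobenius pairing, without conjugation. Since \<open>V\<close> is real,
  taking real parts acts on \<open>Z\<close> alone.\<close>

definition mat_cdot :: "real^'c^'r \<Rightarrow> complex^'c^'r \<Rightarrow> complex" where
  "mat_cdot V Z = (\<Sum>i\<in>UNIV. \<Sum>j\<in>UNIV. of_real (V $ i $ j) * Z $ i $ j)"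

lemma mat_dot_uminus_Re: "mat_dot V (map_matrix (\<lambda>z. - Re z) Z) = - Re (mat_cdot V Z)"
  by (simp add: mat_dot_def mat_cdot_def map_matrix_def sum_negf)

lemma mat_cdot_smult: "mat_cdot V (smult_mat c Z) = c * mat_cdot V Z"
  by (simp add: mat_cdot_def map_matrix_def sum_distrib_left mult_ac)

text \<open>The identity \<open>x^H A y = tr (A y x^H)\<close>.\<close>

lemma hinner_mult_vec: "hinner x (A *v y) = trace_mult A (outer_H y x)"
  by (simp add: hinner_def trace_mult_def outer_H_def matrix_vector_mult_def sum_distrib_left mult_ac)

text \<open>The left matrix is the derivative of \<open>V^T V\<close> in direction
  \<open>V'\<close>. Its first summand pairs \<open>V'\<close> with \<open>V K^T\<close> and its
  second with \<open>V K\<close>, which is the origin of the symmetrized factor in the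
  gradient.\<close>

lemma trace_mult_gram:
  fixes V V' :: "real^'c^'r" and K :: "complex^'c^'c"
  shows "trace_mult (cmat (transpose V ** V' + transpose V' ** V)) K
    = mat_cdot V' (cmat V ** (transpose K + K))"
proof -
  have "trace_mult (cmat (transpose V ** V' + transpose V' ** V)) K
    = (\<Sum>i\<in>UNIV. \<Sum>j\<in>UNIV. \<Sum>k\<in>UNIV. of_real (V' $ k $ j) * (of_real (V $ k $ i) * K $ j $ i))
      + (\<Sum>i\<in>UNIV. \<Sum>j\<in>UNIV. \<Sum>k\<in>UNIV. of_real (V' $ k $ i) * (of_real (V $ k $ j) * K $ j $ i))"
    by (simp add: trace_mult_def map_matrix_def matrix_matrix_mult_def transpose_def sum.distrib
        sum_distrib_right sum_distrib_left algebra_simps)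
  also have "(\<Sum>i\<in>UNIV. \<Sum>j\<in>UNIV. \<Sum>k\<in>UNIV. of_real (V' $ k $ j) * (of_real (V $ k $ i) * K $ j $ i))
      = (\<Sum>i\<in>UNIV. \<Sum>k\<in>UNIV. \<Sum>j\<in>UNIV. of_real (V' $ k $ j) * (of_real (V $ k $ i) * K $ j $ i))"
    by (intro sum.cong refl sum.swap)
  also have "\<dots> = (\<Sum>k\<in>UNIV. \<Sum>i\<in>UNIV. \<Sum>j\<in>UNIV. of_real (V' $ k $ j) * (of_real (V $ k $ i) * K $ j $ i))"
    by (rule sum.swap)
  also have "\<dots> = (\<Sum>k\<in>UNIV. \<Sum>j\<in>UNIV. \<Sum>i\<in>UNIV. of_real (V' $ k $ j) * (of_real (V $ k $ i) * K $ j $ i))"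
    by (intro sum.cong refl sum.swap)
  also have "(\<Sum>i\<in>UNIV. \<Sum>j\<in>UNIV. \<Sum>k\<in>UNIV. of_real (V' $ k $ i) * (of_real (V $ k $ j) * K $ j $ i))
      = (\<Sum>i\<in>UNIV. \<Sum>k\<in>UNIV. \<Sum>j\<in>UNIV. of_real (V' $ k $ i) * (of_real (V $ k $ j) * K $ j $ i))"
    by (intro sum.cong refl sum.swap)
  also have "\<dots> = (\<Sum>k\<in>UNIV. \<Sum>i\<in>UNIV. \<Sum>j\<in>UNIV. of_real (V' $ k $ i) * (of_real (V $ k $ j) * K $ j $ i))"
    by (rule sum.swap)
  finally show ?thesis
    by (simp add: mat_cdot_def map_matrix_def matrix_matrix_mult_def transpose_def sum.distrib
        sum_distrib_left algebra_simps)
qed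

text \<open>The entry of \<open>V\<close> at \<open>(i, j)\<close> occurs in \<open>V^T - V\<close>
  with sign plus at \<open>(j, i)\<close> and minus at \<open>(i, j)\<close>; in the trace these
  positions meet \<open>K\<close> at \<open>(i, j)\<close> and \<open>(j, i)\<close>.\<close>

lemma trace_mult_skew: "trace_mult (cmat (transpose V - V)) K = mat_cdot V (K - transpose K)"
proof -
  have "trace_mult (cmat (transpose V)) K = (\<Sum>j\<in>UNIV. \<Sum>i\<in>UNIV. of_real (V $ j $ i) * K $ j $ i)"
    unfolding trace_mult_def by (subst sum.swap) (simp add: map_matrix_def transpose_def)
  then show ?thesis
    by (simp add: trace_mult_def mat_cdot_def map_matrix_def transpose_def sum_subtractf algebra_simps)
qed

lemma trace_mult_cmat: "trace_mult (cmat V) K = mat_cdot V (transpose K)"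
  by (simp add: trace_mult_def mat_cdot_def map_matrix_def transpose_def)

lemma trace_mult_cmat_transpose: "trace_mult (cmat (transpose V)) K = mat_cdot V K"
  unfolding trace_mult_def mat_cdot_def by (subst sum.swap) (simp add: map_matrix_def transpose_def)

lemma mat_cdot_add: "mat_cdot V (Y + Z) = mat_cdot V Y + mat_cdot V Z"
  by (simp add: mat_cdot_def sum.distrib algebra_simps)

lemma sum_UNIV_sum_type:
  "sum f (UNIV :: ('n::finite + 'm::finite) set) = (\<Sum>i\<in>UNIV. f (Inl i)) + (\<Sum>i\<in>UNIV. f (Inr i))"
  using sum.Plus[of "UNIV :: 'n set" "UNIV :: 'm set" f] by (simp add: comp_def)

text \<open>The trace is the product of the row \<open>(-b^H, u^H)\<close>, the matrix
  \<open>W\<close> and the column \<open>(a, v)\<close>. Symmetry of \<open>W\<close> makes its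
  lower left block the transpose of \<open>block_P W\<close>.\<close>

lemma trace_mult_blocks:
  fixes W :: "real^('n::finite + 'm::finite)^('n + 'm)"
  assumes "transpose W = W"
  shows "trace_mult (cmat W) (outer_H (vec_append a v) (vec_append (- b) u)) =
    - hinner b (cmat (block_R W) *v a) - hinner b (cmat (block_P W) *v v)
    + hinner u (cmat (transpose (block_P W)) *v a) + hinner u (cmat (block_S W) *v v)"
proof -
  have "W $ Inr i $ Inl j = W $ Inl j $ Inr i" for i j
    using arg_cong[OF assms, of "\<lambda>X. X $ Inr i $ Inl j"] by (simp add: transpose_def)
  then show ?thesis
    by (simp add: hinner_mult_vec trace_mult_def sum_UNIV_sum_type outer_H_def vec_append_def
        block_R_def block_P_def block_S_def map_matrix_def transpose_def sum.distrib sum_negf)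
qed

lemma cmat_add: "cmat (A + B) = cmat A + cmat B"
  and cmat_diff: "cmat (A - B) = cmat A - cmat B"
  by (simp_all add: map_matrix_def vec_eq_iff)

lemma transpose_add: "transpose (A + B) = transpose A + transpose (B :: 'a::plus^'c^'r)"
  by (simp add: transpose_def vec_eq_iff)

lemma smult_mat_mult_vec: "smult_mat c A *v x = c *s (A *v x)"
  by (simp add: map_matrix_def matrix_vector_mult_def vec_eq_iff sum_distrib_left mult_ac)

lemma uminus_mult_vec: "(- A) *v x = - (A *v (x :: 'a::ring_1^'c))"
  by (simp add: matrix_vector_mult_def vec_eq_iff sum_negf)

lemma conj_transpose_cmat: "conj_transpose (cmat (transpose A)) = cmat A"
  by (simp add: conj_transpose_def map_matrix_def transpose_def vec_eq_iff)

text \<open>From the left \<open>u^H (B + P)^T C\<close> collapses to \<open>b^H\<close>, and from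
  the right \<open>C (B - P) v\<close> collapses to \<open>a\<close>. The contributions of the
  blocks \<open>R\<close>, \<open>P\<close> and \<open>S\<close> then combine into a single trace
  with \<open>W'\<close>.\<close>

lemma hinner_transfer_derivative:
  fixes B P :: "real^'m^'n" and C :: "complex^'n^'n" and W' :: "real^('n + 'm)^('n + 'm)"
  assumes a: "a = C *v (cmat (B - P) *v v)"
    and b: "b = conj_transpose C *v (cmat (B + P) *v u)"
    and sym: "transpose W' = W'"
  shows "hinner u ((cmat (transpose (B + P)) ** C ** cmat (B' - block_P W')
      + (cmat (transpose (B + P)) ** - (C ** (smult_mat s (cmat E') - cmat (J' - block_R W')) ** C)
        + cmat (transpose (B' + block_P W')) ** C) ** cmat (B - P)
      + cmat (block_S W') + cmat N') *v v)
    = - s * trace_mult (cmat E') (outer_H a b) + trace_mult (cmat J') (outer_H a b)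
      + trace_mult (cmat W') (outer_H (vec_append a v) (vec_append (- b) u))
      + mat_cdot B' (outer_H a u + transpose (outer_H v b)) + trace_mult (cmat N') (outer_H v u)"
proof -
  have left: "hinner u (cmat (transpose (B + P)) *v (C *v y)) = hinner b y" for y
    by (simp add: b hinner_adjoint[of _ "cmat (transpose (B + P))"] hinner_adjoint[of _ C] conj_transpose_cmat)
  have B': "mat_cdot B' (outer_H a u + transpose (outer_H v b))
      = hinner u (cmat (transpose B') *v a) + hinner b (cmat B' *v v)"
    unfolding hinner_mult_vec trace_mult_cmat_transpose mat_cdot_add by (simp add: trace_mult_cmat)
  have "hinner u ((cmat (transpose (B + P)) ** C ** cmat (B' - block_P W')
      + (cmat (transpose (B + P)) ** - (C ** (smult_mat s (cmat E') - cmat (J' - block_R W')) ** C)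
        + cmat (transpose (B' + block_P W')) ** C) ** cmat (B - P)
      + cmat (block_S W') + cmat N') *v v)
    = hinner b (cmat (B' - block_P W') *v v)
      - hinner b ((smult_mat s (cmat E') - cmat (J' - block_R W')) *v a)
      + hinner u (cmat (transpose (B' + block_P W')) *v a)
      + hinner u (cmat (block_S W') *v v) + hinner u (cmat N' *v v)"
    by (simp only: matrix_vector_mult_add_rdistrib matrix_vector_mul_assoc[symmetric] hinner_add_right
        uminus_mult_vec vec.neg hinner_minus_right left a[symmetric]) simp
  also have "\<dots> = - s * trace_mult (cmat E') (outer_H a b) + trace_mult (cmat J') (outer_H a b)
      + trace_mult (cmat W') (outer_H (vec_append a v) (vec_append (- b) u))
      + mat_cdot B' (outer_H a u + transpose (outer_H v b)) + trace_mult (cmat N') (outer_H v u)"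
    unfolding trace_mult_blocks[OF sym] B'
    unfolding hinner_mult_vec[symmetric] cmat_add cmat_diff transpose_add
    by (simp add: matrix_vector_mult_add_rdistrib matrix_vector_mult_diff_rdistrib hinner_add_right
        hinner_diff_right smult_mat_mult_vec hinner_smult_right algebra_simps del: transpose_matrix_vector)
  finally show ?thesis .
qed

section \<open>Slices of the parameter vector\<close>

lemma linear_nth_take_drop:
  assumes "k < l" "off + l \<le> CARD('p::{finite,linorder})"
  shows "linear (\<lambda>\<theta> :: real^'p::{finite,linorder}. take l (drop off (vec_to_list \<theta>)) ! k)"
proof -
  have "take l (drop off (vec_to_list \<theta>)) ! k = \<theta> $ (idxs ! (off + k))" for \<theta> :: "real^'p::{finite,linorder}"
    using assms by (simp add: vec_to_list_def)
  then show ?thesis by (simp add: linearI)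
qed

definition num_par :: "('n::finite \<times> 'm::finite) itself \<Rightarrow> nat" where
  "num_par d = len_E d + len_J d + len_W d + len_B d + len_N d"

text \<open>Each product of consecutive numbers is even, so the divisions by two are exact and the
  block lengths add up to the prescribed dimension.\<close>

lemma real_num_par:
  fixes d :: "('n::finite \<times> 'm::finite) itself"
  shows "real (num_par d) =
    real CARD('n) * ((3 * real CARD('n) + 1) / 2 + 2 * real CARD('m)) + (real CARD('m))\<^sup>2"
proof -
  have *: "real (k * (k + 1) div 2) = real k * (real k + 1) / 2" for k
    by (subst real_of_nat_div) (auto simp: algebra_simps)
  have **: "real (k * (k - 1) div 2) = real k * (real k - 1) / 2" if "k > 0" for k
    using that by (subst real_of_nat_div) (auto simp: algebra_simps of_nat_diff)
  have pos: "CARD('n) > 0" "CARD('m) > 0" by simp_all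
  show ?thesis
    unfolding num_par_def len_E_def len_J_def len_W_def len_B_def len_N_def of_nat_add * **[OF pos(1)] **[OF pos(2)]
    by (simp add: field_simps power2_eq_square)
qed

lemma linear_par:
  fixes d :: "('n::{finite,linorder} \<times> 'm::{finite,linorder}) itself"
  assumes "num_par d = CARD('p::{finite,linorder})"
  shows "linear (\<lambda>\<theta> :: real^'p::{finite,linorder}. vtu (par_E d \<theta>) :: real^'n::{finite,linorder}^'n::{finite,linorder})"
    and "linear (\<lambda>\<theta> :: real^'p::{finite,linorder}. vtsu (par_J d \<theta>) :: real^'n::{finite,linorder}^'n::{finite,linorder})"
    and "linear (\<lambda>\<theta> :: real^'p::{finite,linorder}. vtu (par_W d \<theta>) :: real^('n::{finite,linorder} + 'm::{finite,linorder})^('n::{finite,linorder} + 'm::{finite,linorder}))"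
    and "linear (\<lambda>\<theta> :: real^'p::{finite,linorder}. vtf (par_B d \<theta>) :: real^'m::{finite,linorder}^'n::{finite,linorder})"
    and "linear (\<lambda>\<theta> :: real^'p::{finite,linorder}. vtsu (par_N d \<theta>) :: real^'m::{finite,linorder}^'m::{finite,linorder})"
  subgoal
    using assms unfolding num_par_def par_E_def
    by (intro linear_vtu linear_nth_take_drop[where off = 0, simplified]) (auto simp: len_E_def)
  subgoal
    using assms unfolding num_par_def par_J_def
    by (intro linear_vtsu linear_nth_take_drop) (auto simp: len_J_def)
  subgoal
    using assms unfolding num_par_def par_W_def
    by (intro linear_vtu linear_nth_take_drop) (auto simp: len_W_def)
  subgoal
    using assms unfolding num_par_def par_B_def
    by (intro linear_vtf linear_nth_take_drop) (auto simp: len_B_def)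
  subgoal
    using assms unfolding num_par_def par_N_def
    by (intro linear_vtsu linear_nth_take_drop) (auto simp: len_N_def)
  done

lemma has_derivative_of_linear: "linear L \<Longrightarrow> (L has_derivative L) F" for L :: "'a::euclidean_space \<Rightarrow> 'b::real_normed_vector"
  by (simp add: bounded_linear_imp_has_derivative linear_conv_bounded_linear)

lemma has_derivative_gram:
  fixes L :: "'a::euclidean_space \<Rightarrow> real^'c^'r"
  assumes "linear L"
  shows "((\<lambda>\<theta>. transpose (L \<theta>) ** L \<theta>) has_derivative
    (\<lambda>h. transpose (L \<theta>) ** L h + transpose (L h) ** L \<theta>)) (at \<theta>)"
  by (intro has_derivative_matrix_mult has_derivative_linear[OF linear_transpose] has_derivative_of_linear assms)

lemma has_derivative_pH_parts:
  fixes d :: "('n::{finite,linorder} \<times> 'm::{finite,linorder}) itself" and \<theta> :: "real^'p::{finite,linorder}"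
  assumes "num_par d = CARD('p::{finite,linorder})"
  shows "(pH_E d has_derivative (\<lambda>h. transpose (vtu (par_E d \<theta>)) ** vtu (par_E d h)
      + transpose (vtu (par_E d h)) ** vtu (par_E d \<theta>))) (at \<theta>)"
    and "(pH_J d has_derivative pH_J d) (at \<theta>)"
    and "(pH_W d has_derivative (\<lambda>h. transpose (vtu (par_W d \<theta>)) ** vtu (par_W d h)
      + transpose (vtu (par_W d h)) ** vtu (par_W d \<theta>))) (at \<theta>)"
    and "(pH_B d has_derivative pH_B d) (at \<theta>)"
    and "(pH_N d has_derivative pH_N d) (at \<theta>)"
  unfolding pH_E_def[abs_def] pH_J_def[abs_def] pH_W_def[abs_def] pH_B_def[abs_def] pH_N_def[abs_def]
  by (intro has_derivative_gram linear_par[OF assms] has_derivative_diff has_derivative_linear[OF linear_transpose]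
      has_derivative_of_linear)+

section \<open>Assembly of the gradient\<close>

lemma H_pH_derivative:
  fixes d :: "('n::{finite,linorder} \<times> 'm::{finite,linorder}) itself" and \<theta> :: "real^'p::{finite,linorder}"
  assumes np: "num_par d = CARD('p::{finite,linorder})" and inv: "invertible (pH_pencil d s \<theta>)"
    and a: "a = matrix_inv (pH_pencil d s \<theta>) *v (cmat (pH_B d \<theta> - pH_P d \<theta>) *v v)"
    and b: "b = conj_transpose (matrix_inv (pH_pencil d s \<theta>)) *v (cmat (pH_B d \<theta> + pH_P d \<theta>) *v u)"
    and M: "M = outer_H (vec_append a v) (vec_append (- b) u)"
  obtains H' where "(H_pH d s has_derivative H') (at \<theta>)"
    and "\<forall>h. hinner u (H' h *v v) =
        mat_cdot (vtu (par_E d h))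
          (smult_mat (- s) (cmat (vtu (par_E d \<theta>)) ** (transpose (outer_H a b) + outer_H a b)))
        + mat_cdot (vtsu (par_J d h)) (outer_H a b - transpose (outer_H a b))
        + mat_cdot (vtu (par_W d h)) (cmat (vtu (par_W d \<theta>)) ** (transpose M + M))
        + mat_cdot (vtf (par_B d h)) (outer_H a u + transpose (outer_H v b))
        + mat_cdot (vtsu (par_N d h)) (outer_H v u - transpose (outer_H v u))"
proof -
  \<comment> \<open>The derivative of a Gram matrix is symmetric, as
    \<open>hinner_transfer_derivative\<close> demands of \<open>W'\<close>.\<close>
  have sym: "transpose (transpose V ** V' + transpose V' ** V) = transpose V ** V' + transpose V' ** V"
    for V V' :: "real^('n::{finite,linorder} + 'm::{finite,linorder})^('n::{finite,linorder} + 'm::{finite,linorder})"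
    by (simp add: transpose_add matrix_transpose_mul add.commute)
  note der = has_derivative_H_pH[OF has_derivative_pH_parts[OF np] inv]
  show ?thesis
  proof (rule that[OF der])
  qed (intro allI, subst hinner_transfer_derivative[OF a b sym], simp only: trace_mult_gram mat_cdot_smult pH_J_def pH_N_def
      trace_mult_skew pH_B_def M)
qed

lemma inner_list_to_vec_append:
  fixes d :: "('n::{finite,linorder} \<times> 'm::{finite,linorder}) itself" and h :: "real^'p::{finite,linorder}"
  assumes "num_par d = CARD('p::{finite,linorder})"
    and "length xE = len_E d" "length xJ = len_J d" "length xW = len_W d" "length xB = len_B d" "length xN = len_N d"
  shows "h \<bullet> list_to_vec (xE @ xJ @ xW @ xB @ xN) = dot_list (par_E d h) xE + dot_list (par_J d h) xJ
    + dot_list (par_W d h) xW + dot_list (par_B d h) xB + dot_list (par_N d h) xN"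
proof -
  have len: "length (vec_to_list h) = CARD('p)" by (simp add: vec_to_list_def)
  have "h \<bullet> list_to_vec (xE @ xJ @ xW @ xB @ xN) = dot_list (vec_to_list h) (xE @ xJ @ xW @ xB @ xN)"
    using assms by (subst dot_list_vec_to_list) (auto simp: num_par_def)
  also have "\<dots> = dot_list (par_E d h) xE + dot_list (par_J d h) xJ
    + dot_list (par_W d h) xW + dot_list (par_B d h) xB + dot_list (par_N d h) xN"
    using assms len unfolding par_E_def par_J_def par_W_def par_B_def par_N_def num_par_def
    by (simp add: dot_list_append_right add_ac)
  finally show ?thesis .
qed

lemma length_par:
  fixes d :: "('n::{finite,linorder} \<times> 'm::{finite,linorder}) itself" and h :: "real^'p::{finite,linorder}"
  assumes "num_par d = CARD('p::{finite,linorder})"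
  shows "length (par_E d h) = len_E d" "length (par_J d h) = len_J d" "length (par_W d h) = len_W d"
    "length (par_B d h) = len_B d" "length (par_N d h) = len_N d"
  using assms by (auto simp: par_E_def par_J_def par_W_def par_B_def par_N_def num_par_def vec_to_list_def)

lemma dot_list_map_uminus_Re:
  shows "length w = CARD('k::{finite,linorder}) * (CARD('k::{finite,linorder}) + 1) div 2 \<Longrightarrow>
      dot_list w (map (\<lambda>z. - Re z) (utv Z)) = - Re (mat_cdot (vtu w) (Z :: complex^'k::{finite,linorder}^'k::{finite,linorder}))"
    and "length w = CARD('k::{finite,linorder}) * (CARD('k::{finite,linorder}) - 1) div 2 \<Longrightarrow>
      dot_list w (map (\<lambda>z. - Re z) (sutv Z)) = - Re (mat_cdot (vtsu w) (Z :: complex^'k::{finite,linorder}^'k::{finite,linorder}))"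
    and "length w = CARD('r::{finite,linorder}) * CARD('c::{finite,linorder}) \<Longrightarrow>
      dot_list w (map (\<lambda>z. - Re z) (vec_cols Y)) = - Re (mat_cdot (vtf w) (Y :: complex^'c::{finite,linorder}^'r::{finite,linorder}))"
  by (simp_all only: map_utv map_sutv map_vec_cols dot_list_utv dot_list_sutv dot_list_vec_cols mat_dot_uminus_Re)

text \<open>The inner product splits along the five slices, and adjointness turns each part into a
  matrix pairing with the reshaped slice of \<open>h\<close>. A list built this way thus represents
  the linear functional on the right.\<close>

lemma inner_gradient:
  fixes d :: "('n::{finite,linorder} \<times> 'm::{finite,linorder}) itself" and h :: "real^'p::{finite,linorder}"
    and ZE ZJ :: "complex^'n::{finite,linorder}^'n::{finite,linorder}"
    and ZW :: "complex^('n::{finite,linorder} + 'm::{finite,linorder})^('n::{finite,linorder} + 'm::{finite,linorder})"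
    and ZB :: "complex^'m::{finite,linorder}^'n::{finite,linorder}"
    and ZN :: "complex^'m::{finite,linorder}^'m::{finite,linorder}"
  assumes np: "num_par d = CARD('p::{finite,linorder})"
  shows "h \<bullet> list_to_vec (map (\<lambda>z. - Re z) (utv ZE) @ map (\<lambda>z. - Re z) (sutv ZJ) @
      map (\<lambda>z. - Re z) (utv ZW) @ map (\<lambda>z. - Re z) (vec_cols ZB) @ map (\<lambda>z. - Re z) (sutv ZN))
    = - Re (mat_cdot (vtu (par_E d h)) ZE + mat_cdot (vtsu (par_J d h)) ZJ + mat_cdot (vtu (par_W d h)) ZW
      + mat_cdot (vtf (par_B d h)) ZB + mat_cdot (vtsu (par_N d h)) ZN)"
  using length_par[OF np, of h]
  by (subst inner_list_to_vec_append[OF np])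
    (simp_all add: length_utv length_sutv length_vec_cols len_E_def len_J_def len_W_def len_B_def len_N_def
      dot_list_map_uminus_Re)

theorem theorem7:
  fixes d :: "('n::{finite,linorder} \<times> 'm::{finite,linorder}) itself"
    and H0 :: "complex^'m::{finite,linorder}^'m::{finite,linorder}"
    and \<theta>0 :: "real^'p::{finite,linorder}"
    and s0 :: complex
    and \<Omega> :: "(real^'p::{finite,linorder}) set"
    and u v :: "complex^'m::{finite,linorder}"
    and \<D>0 :: "complex^'n::{finite,linorder}^'n::{finite,linorder}"
    and a b :: "complex^'n::{finite,linorder}"
    and M :: "complex^('n::{finite,linorder} + 'm::{finite,linorder})^('n::{finite,linorder} + 'm::{finite,linorder})"
    and d\<theta>E d\<theta>J d\<theta>W d\<theta>B d\<theta>N :: "real list"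
  assumes n\<theta>: "real CARD('p) =
      real CARD('n) * ((3 * real CARD('n) + 1) / 2 + 2 * real CARD('m)) + (real CARD('m))\<^sup>2"
    and nbhd: "\<exists>U. open U \<and> \<theta>0 \<in> U \<and> U \<subseteq> \<Omega>"
    and defined_on: "\<forall>\<theta>\<in>\<Omega>. invertible (pH_pencil d s0 \<theta>)"
    and simple: "simple_singular_value (H0 - H_pH d s0 \<theta>0) (Max (singular_values (H0 - H_pH d s0 \<theta>0)))"
    and nonzero: "H0 - H_pH d s0 \<theta>0 \<noteq> 0"
    and uv: "singular_vectors (H0 - H_pH d s0 \<theta>0) (Max (singular_values (H0 - H_pH d s0 \<theta>0))) u v"
    and \<D>0: "\<D>0 = smult_mat s0 (cmat (pH_E d \<theta>0)) - cmat (pH_J d \<theta>0 - pH_R d \<theta>0)"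
    and a: "a = matrix_inv \<D>0 *v (cmat (pH_B d \<theta>0 - pH_P d \<theta>0) *v v)"
    and b: "b = conj_transpose (matrix_inv \<D>0) *v (cmat (pH_B d \<theta>0 + pH_P d \<theta>0) *v u)"
    and M: "M = outer_H (vec_append a v) (vec_append (- b) u)"
    and d\<theta>E: "d\<theta>E = map (\<lambda>z. - Re z)
      (utv (smult_mat (- s0) (cmat (vtu (par_E d \<theta>0)) ** (transpose (outer_H a b) + outer_H a b))))"
    and d\<theta>J: "d\<theta>J = map (\<lambda>z. - Re z) (sutv (outer_H a b - transpose (outer_H a b)))"
    and d\<theta>W: "d\<theta>W = map (\<lambda>z. - Re z)
      (utv (cmat (vtu (par_W d \<theta>0)) ** (transpose M + M)))"
    and d\<theta>B: "d\<theta>B = map (\<lambda>z. - Re z) (vec_cols (outer_H a u + transpose (outer_H v b)))"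
    and d\<theta>N: "d\<theta>N = map (\<lambda>z. - Re z) (sutv (outer_H v u - transpose (outer_H v u)))"
  shows "(\<exists>U. open U \<and> \<theta>0 \<in> U \<and>
        (\<forall>\<theta>\<in>U. (\<lambda>\<theta>. spectral_norm (H0 - H_pH d s0 \<theta>)) differentiable (at \<theta>)))
    \<and> (invertible \<D>0 \<longrightarrow>
        GDERIV (\<lambda>\<theta>. spectral_norm (H0 - H_pH d s0 \<theta>)) \<theta>0 :>
          list_to_vec (d\<theta>E @ d\<theta>J @ d\<theta>W @ d\<theta>B @ d\<theta>N))"
proof -
  let ?X = "\<lambda>\<theta>. H0 - H_pH d s0 \<theta>"
  have np: "num_par d = CARD('p::{finite,linorder})"
    unfolding of_nat_eq_iff[where 'a = real, symmetric] real_num_par n\<theta> ..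
  obtain U where U: "open U" "\<theta>0 \<in> U" "U \<subseteq> \<Omega>" using nbhd by blast
  have X_diff: "\<exists>X'. (?X has_derivative X') (at \<theta>)" if "\<theta> \<in> U" for \<theta>
  proof -
    have "invertible (pH_pencil d s0 \<theta>)" using that U defined_on by blast
    then obtain H' where "(H_pH d s0 has_derivative H') (at \<theta>)"
      \<comment> \<open>Here \<open>a\<close>, \<open>b\<close> and \<open>M\<close> are replaced by
        their defining terms at \<open>\<theta>\<close>; only the existence of the derivative is
        extracted.\<close>
      by (rule H_pH_derivative[OF np _ refl refl refl, where u = u and v = v])
    from has_derivative_diff[OF has_derivative_const this] show ?thesis by blast
  qed
  \<comment> \<open>On \<open>V\<close> the difference is nonzero and its maximal singular value is
    simple; \<open>V\<close> is open because the excluded set is closed.\<close>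
  define V where "V = U \<inter> ?X -` (- (insert 0 degenerate_top))"
  have "continuous_on U ?X"
    using X_diff by (meson continuous_at_imp_continuous_on has_derivative_continuous)
  moreover have "open (- insert 0 (degenerate_top :: (complex^'m::{finite,linorder}^'m::{finite,linorder}) set))"
    by (intro open_Compl closed_insert closed_degenerate_top)
  ultimately have "open V" unfolding V_def using U(1) by (intro continuous_open_preimage)
  \<comment> \<open>Simplicity does not exclude zero: the \<open>1\<close>-by-\<open>1\<close> zero
    matrix has the simple singular value \<open>0\<close>, while the modulus is not differentiable
    there.\<close>
  have X0: "?X \<theta>0 \<noteq> 0" "?X \<theta>0 \<notin> degenerate_top"
    using nonzero simple_imp_not_degenerate_top simple unfolding spectral_norm_def by blast+
  then have "\<theta>0 \<in> V" using U by (simp add: V_def)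
  have "(\<lambda>\<theta>. spectral_norm (?X \<theta>)) differentiable (at \<theta>)" if "\<theta> \<in> V" for \<theta>
  proof -
    have \<theta>: "\<theta> \<in> U" "?X \<theta> \<noteq> 0" "?X \<theta> \<notin> degenerate_top" using that by (auto simp: V_def)
    obtain X' where X': "(?X has_derivative X') (at \<theta>)" using X_diff \<theta>(1) by blast
    obtain G where "GDERIV spectral_norm (?X \<theta>) :> G" using spectral_norm_has_gradient[OF \<theta>(2,3)] .
    from has_derivative_compose[OF X' this[unfolded gderiv_def]]
    show ?thesis unfolding differentiable_def by blast
  qed
  moreover have "GDERIV (\<lambda>\<theta>. spectral_norm (?X \<theta>)) \<theta>0 :> list_to_vec (d\<theta>E @ d\<theta>J @ d\<theta>W @ d\<theta>B @ d\<theta>N)"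
  proof -
    have D0: "\<D>0 = pH_pencil d s0 \<theta>0" by (simp add: \<D>0 pH_pencil_def)
    have "invertible (pH_pencil d s0 \<theta>0)" using U defined_on by blast
    from H_pH_derivative[OF np this a[unfolded D0] b[unfolded D0] M]
    obtain H' where H': "(H_pH d s0 has_derivative H') (at \<theta>0)"
      and hin: "\<forall>h. hinner u (H' h *v v) =
        mat_cdot (vtu (par_E d h)) (smult_mat (- s0) (cmat (vtu (par_E d \<theta>0)) ** (transpose (outer_H a b) + outer_H a b)))
        + mat_cdot (vtsu (par_J d h)) (outer_H a b - transpose (outer_H a b))
        + mat_cdot (vtu (par_W d h)) (cmat (vtu (par_W d \<theta>0)) ** (transpose M + M))
        + mat_cdot (vtf (par_B d h)) (outer_H a u + transpose (outer_H v b))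
        + mat_cdot (vtsu (par_N d h)) (outer_H v u - transpose (outer_H v u))" .
    have uv': "norm u = 1" "norm v = 1" "?X \<theta>0 *v v = spectral_norm (?X \<theta>0) *\<^sub>R u"
      using uv by (simp_all add: singular_vectors_def spectral_norm_def smult_of_real)
    \<comment> \<open>The given singular vectors form a maximizer, so \<open>outer_H u v\<close> is
      the gradient of the spectral norm.\<close>
    then have "outer_H u v \<bullet> ?X \<theta>0 = spectral_norm (?X \<theta>0)" by (simp add: inner_outer_H norm_eq_1)
    then have "GDERIV spectral_norm (?X \<theta>0) :> outer_H u v" using X0 uv' by (intro GDERIV_spectral_norm)
    from has_derivative_compose[OF has_derivative_diff[OF has_derivative_const H'] this[unfolded gderiv_def]]
    have "((\<lambda>\<theta>. spectral_norm (?X \<theta>)) has_derivative (\<lambda>h. (0 - H' h) \<bullet> outer_H u v)) (at \<theta>0)" .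
    \<comment> \<open>The left side is \<open>- Re (u^H (H' h) v)\<close>; its sign, due to
      subtracting the transfer function from \<open>H0\<close>, is the minus in every gradient
      block.\<close>
    moreover have "(0 - H' h) \<bullet> outer_H u v = h \<bullet> list_to_vec (d\<theta>E @ d\<theta>J @ d\<theta>W @ d\<theta>B @ d\<theta>N)" for h
      unfolding d\<theta>E d\<theta>J d\<theta>W d\<theta>B d\<theta>N inner_gradient[OF np] hin[rule_format, symmetric]
      by (simp add: inner_outer_H inner_eq_Re_hinner[symmetric] inner_commute[of "H' h"])
    ultimately show ?thesis unfolding gderiv_def by simp
  qed
  ultimately show ?thesis using \<open>open V\<close> \<open>\<theta>0 \<in> V\<close> by blast
qed

end
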